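(* Let $a,b$ be nonzero complex numbers such that the line $$\ell\colon\ \bar x+a\bar z+b\bar w=0,\qquad \bar y=t=0$$ on $X_0$ satisfies $\ell\cap L\subset\mathcal S$. Let $b_{1,\bar x},b_{1,\bar z},b_{1,\bar w}$ be the values of $b_1$ at the three points $p_1,p_2,p_3$ of intersection of $\ell$ with $\{\bar x=0\},\{\bar z=0\},\{\bar w=0\}$ respectively, as defined in the context. Then the line $\ell$ has a first order lift if and only if $$a\,b_{1,\bar x}-a b\,b_{1,\bar w}-b_{1,\bar z}=0 .$$
   Context: Let $\mathfrak X=\{\bar x\bar y\bar z\bar w+tf=0\}\subset\mathbb P^3\times\mathbb C$, where $f$ is a homogeneous quartic polynomial, $X_0$ is the fibre over $t=0$ (a union of four coordinate planes), $L$ is the union of the six coordinate lines of $\mathbb P^3$, and $\mathcal S=L\cap\{f=0\}\subset X_0$ is the set of singular points of $\mathfrak X$ on $X_0$. The polynomial $f$ is assumed generic among those for which the three points $p_1,p_2,p_3$ of $\ell\cap L$ lie in $\mathcal S$; in particular $\mathcal S$ consists of $24$ distinct points, none of which is a torus fixed point. Definition of $b_1$ at a point. At each $p_j$ use inhomogeneous coordinates $(u,v,y)$ such that $\mathfrak X$ is $uvy+tf=0$ ($f$ dehomogenized), $u(p_j)=0$, $y(p_j)=0$ and $v(p_j)=\alpha\neq0$: - at $p_1$: $u=\bar x/\bar w$, $v=\bar z/\bar w$, $y=\bar y/\bar w$, $\alpha=-b/a$; - at $p_2$: $u=\bar z/\bar w$, $v=\bar x/\bar w$, $y=\bar y/\bar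 w$, $\alpha=-b$; - at $p_3$: $u=\bar w/\bar x$, $v=\bar z/\bar x$, $y=\bar y/\bar x$, $\alpha=-1/a$. Put $\tilde v=v-\alpha$; then $\ell$ is $\tilde v=\kappa u$, $y=t=0$, with $\kappa=-1/a,\,-a,\,-b/a$ at $p_1,p_2,p_3$ respectively. Write $f=\tilde v f_1(\tilde v)+uf_2(u,\tilde v)+yf_3$, with $f_1,f_2,f_3$ polynomials and $f_1(0)\neq0$, and put $f_4=f_3/(\tilde v+\alpha)$, $f_5=-f_2f_3/(\tilde v+\alpha)$. Then, with $f_i(0)$ denoting the value at the point, $$b_1=\frac{\kappa f_1(0)f_4(0)-f_5(0)}{f_1(0)} .$$ (It is the constant term in the first order perturbation $\tilde v=\kappa s+t(a_1s+b_1)+\cdots$, $u=s$, of a local lift.) First order lift. The functions $X=u+tf_4$, $Y=y(\tilde v+\alpha)+tf_2$, $Z=\tilde vf_1+tf_5$ identify $\mathfrak X$ near $p_j$ with $\{XY+tZ=0\}$ near the origin. A neighbourhood of $\ell$ in $\mathfrak X$ carries the log structure which near each $p_j$ is the toric log structure of $XY+tZ=0$ and elsewhere is pulled back from the toric log structure of $\operatorname{Spec}\mathbb C[t]$; $\mathbb P^1\cong\ell$ carries the log structure of the divisor $p_1+p_2+p_3$ (together with that of the base). The embedding $\varphi_0\colon\mathbb P^1\cong\ell\to\mathfrak X$ is a log morphism, sending near $p_j$ the ghost sheaf generators of $X,Y,Z,t$ to $\tau_S,0,\tau_S,\tau_t$, where $\tau_S,\tau_t$ correspond to the local coordinate $S$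 on $\mathbb P^1$ at $p_j$ and to $t$. A first order lift of $\ell$ is an extension of $\varphi_0$ to a log morphism $\mathbb P^1\times\operatorname{Spec}\mathbb C[t]/(t^2)\to\mathfrak X$ over $\operatorname{Spec}\mathbb C[t]/(t^2)$. Near $p_j$, with a suitable coordinate $S$ on the curve over $\mathbb C[t]/(t^2)$, such lifts have the form $X=S$, $Z=-S\bar h_1(S)-tS\bar h_2(S)$, $Y=t\bar h_1(S)$, where $\bar h_1$ and $\bar h_2$ are analytic. Moreover $Y=t\bar h_1(S)+t^2\bar h_2(S)+\cdots$ for lifts to higher order.
   Formalization: The ghost generator of Y is sent to τ_t rather than to 0 as printed: since XY+tZ=0, the printed images would give τ_S=τ_S+τ_t, so the embedding of the line would not be a log morphism; τ_t agrees with the stated form Y=t·h̄₁(S) of the lifts. *)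

theory Defs
  imports "HOL-Complex_Analysis.Complex_Analysis"
begin

section \<open>The ring \<open>\<complex>[t]/(t\<^sup>2)\<close>\<close>

datatype dual = Dual (re0: complex) (re1: complex)

instantiation dual :: comm_ring_1
begin
definition "0 = Dual 0 0"
definition "1 = Dual 1 0"
definition "x + y = Dual (re0 x + re0 y) (re1 x + re1 y)"
definition "- x = Dual (- re0 x) (- re1 x)"
definition "x - y = Dual (re0 x - re0 y) (re1 x - re1 y)"
definition "x * y = Dual (re0 x * re0 y) (re0 x * re1 y + re1 x * re0 y)"
instance
  by standard
    (simp_all add: zero_dual_def one_dual_def plus_dual_def uminus_dual_def minus_dual_def
      times_dual_def algebra_simps)
end

text \<open>The inverse is the true inverse on units, i.e. on elements with \<open>re0 x \<noteq> 0\<close>, and \<open>0\<close>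
  on all other elements.\<close>

instantiation dual :: inverse
begin
definition "inverse x = Dual (inverse (re0 x)) (- re1 x / (re0 x)\<^sup>2)"
definition "x div y = x * inverse (y :: dual)"
instance ..
end

lemma dual_mult_inverse: "re0 x \<noteq> 0 \<Longrightarrow> x * inverse x = 1"
  by (simp add: times_dual_def inverse_dual_def one_dual_def field_simps power2_eq_square)

definition tt :: dual where "tt = Dual 0 1"

definition cst :: "complex \<Rightarrow> dual" where "cst c = Dual c 0"

lemma tt_square: "tt * tt = 0"
  by (simp add: tt_def times_dual_def zero_dual_def)

text \<open>A function \<open>g :: complex \<Rightarrow> dual\<close> stands for \<open>g\<^sub>0 + t g\<^sub>1\<close>, a function on
  \<open>U \<times> Spec \<complex>[t]/(t\<^sup>2)\<close> for an open \<open>U\<close> of \<open>\<complex>\<close>.\<close>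

definition dual_holomorphic_on :: "(complex \<Rightarrow> dual) \<Rightarrow> complex set \<Rightarrow> bool" where
  "dual_holomorphic_on g U \<longleftrightarrow>
     (\<lambda>s. re0 (g s)) holomorphic_on U \<and> (\<lambda>s. re1 (g s)) holomorphic_on U"

definition dual_analytic_at :: "(complex \<Rightarrow> dual) \<Rightarrow> complex \<Rightarrow> bool" where
  "dual_analytic_at g p \<longleftrightarrow>
     (\<lambda>s. re0 (g s)) analytic_on {p} \<and> (\<lambda>s. re1 (g s)) analytic_on {p}"

section \<open>Homogeneous quartics and projective space\<close>

text \<open>Homogeneous coordinates are listed in the order \<open>(x, y, z, w)\<close>. A quartic form is given by
  its coefficients; only exponents of total degree 4 matter. The parameter \<open>emb\<close> embeds
  \<open>\<complex>\<close> into the ring in which the form is evaluated.\<close>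

type_synonym 'a quad = "'a \<times> 'a \<times> 'a \<times> 'a"

type_synonym quartic = "nat quad \<Rightarrow> complex"

definition quartic_exponents :: "nat quad set" where
  "quartic_exponents = {(i, j, k, l). i + j + k + l = 4}"

fun quartic_eval :: "(complex \<Rightarrow> 'a::comm_ring_1) \<Rightarrow> quartic \<Rightarrow> 'a quad \<Rightarrow> 'a" where
  "quartic_eval emb f (x, y, z, w) =
     (\<Sum>(i, j, k, l)\<in>quartic_exponents. emb (f (i, j, k, l)) * x ^ i * y ^ j * z ^ k * w ^ l)"

fun scale_quad :: "'a::times \<Rightarrow> 'a quad \<Rightarrow> 'a quad" where
  "scale_quad c (x, y, z, w) = (c * x, c * y, c * z, c * w)"

definition proj_pt :: "complex quad \<Rightarrow> complex quad set" where
  "proj_pt q = {scale_quad c q |c. c \<noteq> 0}"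

definition coord_lines :: "complex quad set set" where
  "coord_lines = {proj_pt (x, y, z, w) |x y z w. (x, y, z, w) \<noteq> (0, 0, 0, 0) \<and>
     (x = 0 \<and> y = 0 \<or> x = 0 \<and> z = 0 \<or> x = 0 \<and> w = 0 \<or>
      y = 0 \<and> z = 0 \<or> y = 0 \<and> w = 0 \<or> z = 0 \<and> w = 0)}"

definition zero_locus :: "quartic \<Rightarrow> complex quad set set" where
  "zero_locus f = {proj_pt q |q. q \<noteq> (0, 0, 0, 0) \<and> quartic_eval id f q = 0}"

definition sing_pts :: "quartic \<Rightarrow> complex quad set set" where
  "sing_pts f = coord_lines \<inter> zero_locus f"

definition torus_fixed_pts :: "complex quad set set" where
  "torus_fixed_pts = {proj_pt (1, 0, 0, 0), proj_pt (0, 1, 0, 0),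
                      proj_pt (0, 0, 1, 0), proj_pt (0, 0, 0, 1)}"

definition the_line :: "complex \<Rightarrow> complex \<Rightarrow> complex quad set set" where
  "the_line a b = {proj_pt (x, y, z, w) |x y z w.
     (x, y, z, w) \<noteq> (0, 0, 0, 0) \<and> x + a * z + b * w = 0 \<and> y = 0}"

section \<open>Local coordinates at the three points of the line\<close>

text \<open>\<open>Px\<close>, \<open>Pz\<close>, \<open>Pw\<close> are the points where the line meets
  \<open>x = 0\<close>, \<open>z = 0\<close>, \<open>w = 0\<close>.\<close>

datatype node = Px | Pz | Pw

fun alpha :: "complex \<Rightarrow> complex \<Rightarrow> node \<Rightarrow> complex" where
  "alpha a b Px = - b / a"
| "alpha a b Pz = - b"
| "alpha a b Pw = - 1 / a"

fun kappa :: "complex \<Rightarrow> complex \<Rightarrow> node \<Rightarrow> complex" where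
  "kappa a b Px = - 1 / a"
| "kappa a b Pz = - a"
| "kappa a b Pw = - b / a"

fun hom_coords :: "node \<Rightarrow> 'a \<Rightarrow> 'a \<Rightarrow> 'a \<Rightarrow> 'a::comm_ring_1 quad" where
  "hom_coords Px u v y = (u, y, v, 1)"
| "hom_coords Pz u v y = (v, y, u, 1)"
| "hom_coords Pw u v y = (1, y, v, u)"

fun coord_u :: "node \<Rightarrow> dual quad \<Rightarrow> dual" where
  "coord_u Px (x, y, z, w) = x / w"
| "coord_u Pz (x, y, z, w) = z / w"
| "coord_u Pw (x, y, z, w) = w / x"

fun coord_v :: "node \<Rightarrow> dual quad \<Rightarrow> dual" where
  "coord_v Px (x, y, z, w) = z / w"
| "coord_v Pz (x, y, z, w) = x / w"
| "coord_v Pw (x, y, z, w) = z / x"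

fun coord_y :: "node \<Rightarrow> dual quad \<Rightarrow> dual" where
  "coord_y Px (x, y, z, w) = y / w"
| "coord_y Pz (x, y, z, w) = y / w"
| "coord_y Pw (x, y, z, w) = y / x"

text \<open>A polynomial in \<open>(u, v', y)\<close>, where \<open>v' = v - \<alpha>\<close>, is a polynomial in \<open>y\<close> over
  polynomials in \<open>u\<close> over polynomials in \<open>v'\<close>. The evaluations take \<open>v'\<close> first, then \<open>u\<close>,
  then \<open>y\<close>.\<close>

definition ev1 :: "(complex \<Rightarrow> 'a::comm_ring_1) \<Rightarrow> complex poly \<Rightarrow> 'a \<Rightarrow> 'a" where
  "ev1 emb p v' = poly (map_poly emb p) v'"

definition ev2 :: "(complex \<Rightarrow> 'a::comm_ring_1) \<Rightarrow> complex poly poly \<Rightarrow> 'a \<Rightarrow> 'a \<Rightarrow> 'a" where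
  "ev2 emb p v' u = poly (map_poly (\<lambda>q. ev1 emb q v') p) u"

definition ev3 ::
  "(complex \<Rightarrow> 'a::comm_ring_1) \<Rightarrow> complex poly poly poly \<Rightarrow> 'a \<Rightarrow> 'a \<Rightarrow> 'a \<Rightarrow> 'a" where
  "ev3 emb p v' u y = poly (map_poly (\<lambda>q. ev2 emb q v' u) p) y"

definition local_f :: "quartic \<Rightarrow> complex \<Rightarrow> complex \<Rightarrow> node \<Rightarrow> complex poly poly poly" where
  "local_f f a b P = quartic_eval (\<lambda>c. [:[:[:c:]:]:]) f
     (hom_coords P [:[:0, 1:]:] [:[:[:alpha a b P, 1:]:]:] [:0, 1:])"

text \<open>\<open>poly_shift 1\<close> drops the constant term and divides by the variable, so that
  \<open>f = v' f\<^sub>1(v') + u f\<^sub>2(u, v') + y f\<^sub>3(u, v', y)\<close> when \<open>f\<close> vanishes at the point; see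
  \<open>local_decomposition\<close> below.\<close>

definition loc_f1 :: "quartic \<Rightarrow> complex \<Rightarrow> complex \<Rightarrow> node \<Rightarrow> complex poly" where
  "loc_f1 f a b P = poly_shift 1 (coeff (coeff (local_f f a b P) 0) 0)"

definition loc_f2 :: "quartic \<Rightarrow> complex \<Rightarrow> complex \<Rightarrow> node \<Rightarrow> complex poly poly" where
  "loc_f2 f a b P = poly_shift 1 (coeff (local_f f a b P) 0)"

definition loc_f3 :: "quartic \<Rightarrow> complex \<Rightarrow> complex \<Rightarrow> node \<Rightarrow> complex poly poly poly" where
  "loc_f3 f a b P = poly_shift 1 (local_f f a b P)"

definition val_f4 :: "(complex \<Rightarrow> 'a::{comm_ring_1,inverse}) \<Rightarrow>
    quartic \<Rightarrow> complex \<Rightarrow> complex \<Rightarrow> node \<Rightarrow> 'a \<Rightarrow> 'a \<Rightarrow> 'a \<Rightarrow> 'a" where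
  "val_f4 emb f a b P v' u y = ev3 emb (loc_f3 f a b P) v' u y / (v' + emb (alpha a b P))"

definition val_f5 :: "(complex \<Rightarrow> 'a::{comm_ring_1,inverse}) \<Rightarrow>
    quartic \<Rightarrow> complex \<Rightarrow> complex \<Rightarrow> node \<Rightarrow> 'a \<Rightarrow> 'a \<Rightarrow> 'a \<Rightarrow> 'a" where
  "val_f5 emb f a b P v' u y =
     - ev2 emb (loc_f2 f a b P) v' u * ev3 emb (loc_f3 f a b P) v' u y / (v' + emb (alpha a b P))"

definition b1 :: "quartic \<Rightarrow> complex \<Rightarrow> complex \<Rightarrow> node \<Rightarrow> complex" where
  "b1 f a b P =
     (let f10 = poly (loc_f1 f a b P) 0; f40 = val_f4 id f a b P 0 0 0; f50 = val_f5 id f a b P 0 0 0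
      in (kappa a b P * f10 * f40 - f50) / f10)"

text \<open>The functions \<open>X\<close>, \<open>Y\<close>, \<open>Z\<close> on the total space near the point \<open>P\<close>, pulled back to
  points with values in \<open>\<complex>[t]/(t\<^sup>2)\<close>.\<close>

definition fun_X :: "quartic \<Rightarrow> complex \<Rightarrow> complex \<Rightarrow> node \<Rightarrow> dual quad \<Rightarrow> dual" where
  "fun_X f a b P q = (let u = coord_u P q; v' = coord_v P q - cst (alpha a b P); y = coord_y P q
     in u + tt * val_f4 cst f a b P v' u y)"

definition fun_Y :: "quartic \<Rightarrow> complex \<Rightarrow> complex \<Rightarrow> node \<Rightarrow> dual quad \<Rightarrow> dual" where
  "fun_Y f a b P q = (let u = coord_u P q; v' = coord_v P q - cst (alpha a b P); y = coord_y P q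
     in y * (v' + cst (alpha a b P)) + tt * ev2 cst (loc_f2 f a b P) v' u)"

definition fun_Z :: "quartic \<Rightarrow> complex \<Rightarrow> complex \<Rightarrow> node \<Rightarrow> dual quad \<Rightarrow> dual" where
  "fun_Z f a b P q = (let u = coord_u P q; v' = coord_v P q - cst (alpha a b P); y = coord_y P q
     in v' * ev1 cst (loc_f1 f a b P) v' + tt * val_f5 cst f a b P v' u y)"

section \<open>The log structure on the curve near a marked point\<close>

text \<open>Near the marked point with parameter \<open>p\<close>, the log structure on
  \<open>\<P>\<^sup>1 \<times> Spec \<complex>[t]/(t\<^sup>2)\<close> is \<open>M = O\<^sup>\<times> \<oplus> \<nat> \<tau>\<^sub>S \<oplus> \<nat> \<tau>\<^sub>t\<close>; \<open>LogSec g m n\<close> is the section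
  \<open>g \<tau>\<^sub>S\<^sup>m \<tau>\<^sub>t\<^sup>n\<close>, and the structure map sends it to \<open>g S\<^sup>m t\<^sup>n\<close> with \<open>S = s - p\<close>.
  Since \<open>t\<^sup>2 = 0\<close>, the structure map is not injective.\<close>

datatype log_sec = LogSec (unit_part: "complex \<Rightarrow> dual") (ord_S: nat) (ord_t: nat)

definition log_germ_at :: "complex \<Rightarrow> log_sec \<Rightarrow> bool" where
  "log_germ_at p m \<longleftrightarrow> dual_analytic_at (unit_part m) p \<and> re0 (unit_part m p) \<noteq> 0"

definition log_mult :: "log_sec \<Rightarrow> log_sec \<Rightarrow> log_sec" where
  "log_mult m n =
     LogSec (\<lambda>s. unit_part m s * unit_part n s) (ord_S m + ord_S n) (ord_t m + ord_t n)"

definition log_unit :: "dual \<Rightarrow> log_sec" where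
  "log_unit c = LogSec (\<lambda>_. c) 0 0"

definition log_tau_t :: log_sec where
  "log_tau_t = LogSec (\<lambda>_. 1) 0 1"

definition log_germ_eq :: "complex \<Rightarrow> log_sec \<Rightarrow> log_sec \<Rightarrow> bool" where
  "log_germ_eq p m n \<longleftrightarrow> ord_S m = ord_S n \<and> ord_t m = ord_t n \<and>
     (\<forall>\<^sub>F s in nhds p. unit_part m s = unit_part n s)"

definition log_struct_map :: "complex \<Rightarrow> log_sec \<Rightarrow> complex \<Rightarrow> dual" where
  "log_struct_map p m s = unit_part m s * cst (s - p) ^ ord_S m * tt ^ ord_t m"

text \<open>The toric log structure of \<open>XY + tZ = 0\<close> has the chart given by the monoid with
  generators \<open>e\<^sub>X, e\<^sub>Y, e\<^sub>Z, e\<^sub>t\<close> and the relation \<open>e\<^sub>X + e\<^sub>Y = e\<^sub>t + e\<^sub>Z\<close>, mapping to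
  \<open>X, Y, -Z, t\<close>. A log enhancement of the germ \<open>F\<close> of a morphism at \<open>p\<close> is therefore the same as
  sections \<open>mX, mY, mZ, mt\<close> over the pullbacks of \<open>X, Y, Z, t\<close> with
  \<open>mX \<cdot> mY = (-1) \<cdot> mt \<cdot> mZ\<close>, and it is over the log point \<open>Spec \<complex>[t]/(t\<^sup>2)\<close> iff
  \<open>mt = \<tau>\<^sub>t\<close>. It extends the log morphism of the central fibre iff it
  has the prescribed ghost images \<open>\<tau>\<^sub>S, \<tau>\<^sub>t, \<tau>\<^sub>S, \<tau>\<^sub>t\<close>: modulo \<open>t\<close> the unit parts of
  \<open>mX\<close> and \<open>mZ\<close> are determined by the pullbacks of \<open>X\<close> and \<open>Z\<close>, because \<open>S\<close> is not a zero
  divisor, and that of \<open>mY\<close> by the relation.\<close>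

definition log_lift_at ::
  "quartic \<Rightarrow> complex \<Rightarrow> complex \<Rightarrow> node \<Rightarrow> complex \<Rightarrow> (complex \<Rightarrow> dual quad) \<Rightarrow> bool" where
  "log_lift_at f a b P p F \<longleftrightarrow> (\<exists>mX mY mZ mt.
     (\<forall>m\<in>{mX, mY, mZ, mt}. log_germ_at p m) \<and>
     (\<forall>\<^sub>F s in nhds p. log_struct_map p mX s = fun_X f a b P (F s)) \<and>
     (\<forall>\<^sub>F s in nhds p. log_struct_map p mY s = fun_Y f a b P (F s)) \<and>
     (\<forall>\<^sub>F s in nhds p. log_struct_map p mZ s = fun_Z f a b P (F s)) \<and>
     (\<forall>\<^sub>F s in nhds p. log_struct_map p mt s = tt) \<and>
     log_germ_eq p (log_mult mX mY) (log_mult (log_unit (- 1)) (log_mult mt mZ)) \<and>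
     log_germ_eq p mt log_tau_t \<and>
     (ord_S mX, ord_t mX) = (1, 0) \<and>
     (ord_S mY, ord_t mY) = (0, 1) \<and>
     (ord_S mZ, ord_t mZ) = (1, 0))"

section \<open>First order lifts\<close>

text \<open>The isomorphism of \<open>\<P>\<^sup>1\<close> with the line is \<open>[s : r] \<mapsto> [-as - br : 0 : s : r]\<close>.\<close>

definition phi0 :: "complex \<Rightarrow> complex \<Rightarrow> complex \<Rightarrow> complex \<Rightarrow> complex quad" where
  "phi0 a b s r = (- a * s - b * r, 0, s, r)"

fun reduce_quad :: "dual quad \<Rightarrow> complex quad" where
  "reduce_quad (x, y, z, w) = (re0 x, re0 y, re0 z, re0 w)"

fun quad_holomorphic :: "(complex \<Rightarrow> dual) quad \<Rightarrow> bool" where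
  "quad_holomorphic (Fx, Fy, Fz, Fw) \<longleftrightarrow> (\<forall>F\<in>{Fx, Fy, Fz, Fw}. dual_holomorphic_on F UNIV)"

fun quad_at :: "(complex \<Rightarrow> dual) quad \<Rightarrow> complex \<Rightarrow> dual quad" where
  "quad_at (Fx, Fy, Fz, Fw) s = (Fx s, Fy s, Fz s, Fw s)"

fun on_total_space :: "quartic \<Rightarrow> dual quad \<Rightarrow> bool" where
  "on_total_space f (x, y, z, w) \<longleftrightarrow> x * y * z * w + tt * quartic_eval cst f (x, y, z, w) = 0"

text \<open>A morphism from \<open>\<P>\<^sup>1 \<times> Spec \<complex>[t]/(t\<^sup>2)\<close> over \<open>Spec \<complex>[t]/(t\<^sup>2)\<close> into the total space,
  reducing to \<open>phi0\<close>: homogeneous coordinates \<open>F\<close> on the chart \<open>s \<mapsto> [s : 1]\<close> and \<open>G\<close> on the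
  chart \<open>r \<mapsto> [1 : r]\<close>, agreeing up to units on the overlap. Homogeneous coordinates defined on
  a whole chart are no restriction: the image of the first (second) chart lies in \<open>w \<noteq> 0\<close>
  (\<open>z \<noteq> 0\<close>), where one may normalise \<open>w = 1\<close> (\<open>z = 1\<close>).\<close>

definition first_order_map ::
  "quartic \<Rightarrow> complex \<Rightarrow> complex \<Rightarrow> (complex \<Rightarrow> dual) quad \<Rightarrow> (complex \<Rightarrow> dual) quad \<Rightarrow> bool" where
  "first_order_map f a b F G \<longleftrightarrow>
     quad_holomorphic F \<and> quad_holomorphic G \<and>
     (\<forall>s. \<exists>c. c \<noteq> 0 \<and> reduce_quad (quad_at F s) = scale_quad c (phi0 a b s 1)) \<and>
     (\<forall>r. \<exists>c. c \<noteq> 0 \<and> reduce_quad (quad_at G r) = scale_quad c (phi0 a b 1 r)) \<and>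
     (\<forall>s. s \<noteq> 0 \<longrightarrow> (\<exists>c. re0 c \<noteq> 0 \<and> quad_at G (1 / s) = scale_quad c (quad_at F s))) \<and>
     (\<forall>s. on_total_space f (quad_at F s)) \<and>
     (\<forall>r. on_total_space f (quad_at G r))"

text \<open>Away from the three marked points both log structures are pulled back from
  \<open>Spec \<complex>[t]/(t\<^sup>2)\<close>, so a morphism over this base has a unique log enhancement there. Uniqueness
  also makes the local enhancements at the marked points, which lie at \<open>[-b/a : 1]\<close>,
  \<open>[0 : 1]\<close> and \<open>[1 : 0]\<close>, glue with it.\<close>

definition has_first_order_lift :: "quartic \<Rightarrow> complex \<Rightarrow> complex \<Rightarrow> bool" where
  "has_first_order_lift f a b \<longleftrightarrow> (\<exists>F G. first_order_map f a b F G \<and>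
     log_lift_at f a b Px (- b / a) (quad_at F) \<and>
     log_lift_at f a b Pz 0 (quad_at F) \<and>
     log_lift_at f a b Pw 0 (quad_at G))"

section \<open>The local decomposition of \<open>f\<close>\<close>

lemma hom_eval:
  fixes g :: "'b::comm_ring_1 \<Rightarrow> 'a::comm_ring_1" and x :: 'a
  assumes "g 0 = 0" "g 1 = 1" "\<And>p q. g (p + q) = g p + g q" "\<And>p q. g (p * q) = g p * g q"
  defines "h \<equiv> \<lambda>p. poly (map_poly g p) x"
  shows "h 0 = 0" "h 1 = 1" "h (p + q) = h p + h q" "h (p * q) = h p * h q"
    "h (pCons c p) = g c + x * h p"
proof -
  show h0: "h 0 = 0" by (simp add: h_def)
  show hp: "h (pCons c p) = g c + x * h p" for c p
    by (simp add: h_def map_poly_pCons assms)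
  show "h 1 = 1" using hp[of 1 0] by (simp add: h0 assms(2) one_pCons)
  have mp_add: "map_poly g (p + q) = map_poly g p + map_poly g q" for p q
    by (rule poly_eqI) (simp add: coeff_map_poly assms)
  show ha: "h (p + q) = h p + h q" for p q
    by (simp add: h_def mp_add)
  have mp_smult: "map_poly g (smult c q) = smult (g c) (map_poly g q)" for c q
    by (rule poly_eqI) (simp add: coeff_map_poly assms)
  have hs: "h (smult c q) = g c * h q" for c q
    by (simp add: h_def mp_smult)
  show "h (p * q) = h p * h q"
  proof (induction p)
    case 0
    show ?case by (simp add: h0)
  next
    case (pCons c p)
    have "h (pCons c p * q) = h (smult c q) + h (pCons 0 (p * q))" by (simp add: ha)
    also have "\<dots> = g c * h q + x * (h p * h q)" by (simp only: hs hp pCons assms(1) add_0)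
    also have "\<dots> = h (pCons c p) * h q" by (simp only: hp algebra_simps)
    finally show ?case .
  qed
qed

context
  fixes emb :: "complex \<Rightarrow> 'a::comm_ring_1"
  assumes emb: "emb 0 = 0" "emb 1 = 1" "\<And>p q. emb (p + q) = emb p + emb q"
    "\<And>p q. emb (p * q) = emb p * emb q"
begin

lemmas ev1_hom = hom_eval[where g = emb, OF emb, folded ev1_def]
lemmas ev2_hom = hom_eval[where g = "\<lambda>q. ev1 emb q v'" for v', OF ev1_hom(1-4), folded ev2_def]
lemmas ev3_hom = hom_eval[where g = "\<lambda>q. ev2 emb q v' u" for v' u, OF ev2_hom(1-4), folded ev3_def]

lemma ev3_power: "ev3 emb (p ^ n) v' u y = ev3 emb p v' u y ^ n"
  by (induction n) (simp_all add: ev3_hom)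

lemma ev3_sum: "ev3 emb (sum p A) v' u y = (\<Sum>i\<in>A. ev3 emb (p i) v' u y)"
  by (induction A rule: infinite_finite_induct) (simp_all add: ev3_hom)

lemma ev3_local_f:
  "ev3 emb (local_f f a b P) v' u y =
   quartic_eval emb f (hom_coords P u (v' + emb (alpha a b P)) y)"
  by (cases P)
    (simp_all add: local_f_def ev3_sum ev3_power ev3_hom ev2_hom ev1_hom emb case_prod_unfold
      add.commute del: mult_pCons_left mult_pCons_right)

end

lemma pCons_poly_shift: "pCons (coeff p 0) (poly_shift 1 p) = p"
  by (rule poly_eqI) (simp add: coeff_pCons coeff_poly_shift split: nat.split)

lemma local_decomposition:
  fixes emb :: "complex \<Rightarrow> 'a::comm_ring_1"
  assumes emb: "emb 0 = 0" "emb 1 = 1" "\<And>p q. emb (p + q) = emb p + emb q"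
      "\<And>p q. emb (p * q) = emb p * emb q"
    and zero: "quartic_eval id f (hom_coords P 0 (alpha a b P) 0) = 0"
  shows "quartic_eval emb f (hom_coords P u (v' + emb (alpha a b P)) y) =
    v' * ev1 emb (loc_f1 f a b P) v' + u * ev2 emb (loc_f2 f a b P) v' u +
    y * ev3 emb (loc_f3 f a b P) v' u y"
proof -
  let ?F = "local_f f a b P"
  have F: "?F = pCons (pCons (pCons (coeff (coeff (coeff ?F 0) 0) 0) (loc_f1 f a b P))
      (loc_f2 f a b P)) (loc_f3 f a b P)" (is "_ = pCons (pCons (pCons ?c _) _) _")
    by (simp only: loc_f1_def loc_f2_def loc_f3_def pCons_poly_shift)
  have id: "ev3 id ?F 0 0 0 = quartic_eval id f (hom_coords P 0 (0 + id (alpha a b P)) 0)"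
    by (rule ev3_local_f) simp_all
  have "ev3 id ?F 0 0 0 = ?c"
    by (subst F) (simp add: ev3_def ev2_def ev1_def map_poly_pCons)
  with id zero have c: "?c = 0" by simp
  have "ev3 emb ?F v' u y = v' * ev1 emb (loc_f1 f a b P) v' + u * ev2 emb (loc_f2 f a b P) v' u +
    y * ev3 emb (loc_f3 f a b P) v' u y"
    by (subst F, unfold c)
      (simp add: ev3_hom(5)[OF emb] ev2_hom(5)[OF emb] ev1_hom(5)[OF emb] emb)
  then show ?thesis by (simp add: ev3_local_f[OF emb])
qed

end

theory Submission
  imports Defs
begin

text \<open>A lift moves the line to first order in \<open>t\<close>. Its displacement normal to the line inside the plane
  \<open>y = 0\<close> is measured by the \<open>t\<close>-coefficient \<open>N\<close> of \<open>x + a z + b w\<close>. The constant term of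
  \<open>x + a z + b w\<close> vanishes, so \<open>N\<close> is multiplied by the same factor as the homogeneous coordinates
  when these are rescaled. It is therefore a section of \<open>O(1)\<close> on the projective line, that is, a
  linear form \<open>n\<^sub>1 s + n\<^sub>0 r\<close>.

  At a marked point the log structure forces the pullbacks of \<open>X\<close> and \<open>Z\<close> to be multiples of the
  local parameter, hence to vanish there modulo \<open>t\<^sup>2\<close>. Writing \<open>u\<^sub>1\<close>, \<open>v\<^sub>1\<close> for the
  \<open>t\<close>-coefficients of \<open>u\<close>, \<open>v\<close> at the point, this says \<open>u\<^sub>1 = - f\<^sub>4(0)\<close> and
  \<open>v\<^sub>1 f\<^sub>1(0) = - f\<^sub>5(0)\<close>. The combination \<open>v\<^sub>1 - \<kappa> u\<^sub>1\<close> is the normal displacement in the local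
  coordinates, and the two equations imply that it equals \<open>b\<^sub>1\<close> (\<open>fun_X_Z_zero_iff\<close>). In the
  trivialisations used here the three points thus prescribe for \<open>N\<close> the values \<open>a b\<^sub>1\<close>, \<open>b\<^sub>1\<close>
  and \<open>- a\<^sup>2 b\<^sub>1\<close> at \<open>Px\<close>, \<open>Pz\<close>, \<open>Pw\<close> (\<open>coords_at_node\<close>). A linear form has two
  coefficients, and it takes these three values iff the stated relation holds.

  Necessity is this computation together with Liouville's theorem (\<open>lift_imp_relation\<close>).
  For sufficiency (\<open>relation_imp_lift\<close>) all four coordinates are taken linear: \<open>N\<close> is determined
  by its values, the remaining freedom in \<open>z\<close> and \<open>w\<close> realises the three prescribed \<open>u\<^sub>1\<close>, and the
  equation of the total space fixes \<open>y = t h\<close>. The form \<open>h\<close> is linear because the quartic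
  restricted to the line is divisible by the linear forms of the three marked points
  (\<open>quartic_on_line_factorization\<close>). Vanishing of \<open>X\<close> and \<open>Z\<close> at the marked point is then enough
  for a log enhancement (\<open>log_lift_atI\<close>): the section over \<open>Y = t (\<dots>)\<close> has a unit part that is
  only determined modulo \<open>t\<close>, and its \<open>t\<close>-coefficient can be chosen so that
  \<open>mX mY = - \<tau>\<^sub>t mZ\<close> holds.

  Both directions need \<open>f\<^sub>1(0) \<noteq> 0\<close>, i.e. that the quartic restricted to a coordinate line has a
  simple zero at the marked point. Each of the six coordinate lines contains at most four zeros,
  and a multiple zero would leave fewer than 24 of them (\<open>loc_f1_nonzero\<close>).\<close>

section \<open>Arithmetic of dual numbers\<close>

lemma dual_eq_iff: "x = y \<longleftrightarrow> re0 x = re0 y \<and> re1 x = re1 y"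
  by (auto intro: dual.expand)

lemma dual_parts [simp]:
  "re0 0 = 0" "re1 0 = 0" "re0 1 = 1" "re1 1 = 0"
  "re0 (x + y) = re0 x + re0 y" "re1 (x + y) = re1 x + re1 y"
  "re0 (x - y) = re0 x - re0 y" "re1 (x - y) = re1 x - re1 y"
  "re0 (- x) = - re0 x" "re1 (- x) = - re1 x"
  "re0 (x * y) = re0 x * re0 y" "re1 (x * y) = re0 x * re1 y + re1 x * re0 y"
  "re0 (cst c) = c" "re1 (cst c) = 0" "re0 tt = 0" "re1 tt = 1"
  "re0 (x / y) = re0 x / re0 y" "re1 (x / y) = re1 x / re0 y - re0 x * re1 y / (re0 y)\<^sup>2"
  by (simp_all add: zero_dual_def one_dual_def plus_dual_def minus_dual_def uminus_dual_def
      times_dual_def cst_def tt_def divide_dual_def inverse_dual_def divide_inverse)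

lemma re0_power [simp]: "re0 (x ^ n) = re0 x ^ n"
  by (induction n) simp_all

lemma re0_sum: "re0 (sum g A) = (\<Sum>i\<in>A. re0 (g i))"
  by (induction A rule: infinite_finite_induct) simp_all

lemma re0_quartic_eval: "re0 (quartic_eval cst f q) = quartic_eval id f (reduce_quad q)"
  by (cases q) (simp add: re0_sum case_prod_unfold)

lemma cst_hom: "cst 0 = 0" "cst 1 = 1" "cst (p + q) = cst p + cst q" "cst (p * q) = cst p * cst q"
  by (simp_all add: dual_eq_iff)

lemma id_hom: "id 0 = (0::complex)" "id 1 = (1::complex)" "id (p + q) = id p + (id q :: complex)"
    "id (p * q) = id p * (id q :: complex)"
  by simp_all

lemmas ev_cst = ev1_hom(1,5)[of cst, OF cst_hom] ev2_hom(1,5)[of cst, OF cst_hom]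
  ev3_hom(1,5)[of cst, OF cst_hom]

lemma ev1_id: "ev1 id p x = poly p x"
  by (simp add: ev1_def map_poly_id)

(* The rule id_apply rewrites the argument id of ev2 and ev3 to an abstraction to which the rules
   below do not apply. Hence the innermost evaluation is turned into poly by ev1_id, and the proofs
   about evaluation use simp only. *)
lemmas ev_id = ev2_hom(1,5)[of id, OF id_hom] ev3_hom(1,5)[of id, OF id_hom]

lemma re0_ev1: "re0 (ev1 cst p x) = poly p (re0 x)"
  by (induction p) (simp_all add: ev_cst)

lemma re0_ev2: "re0 (ev2 cst p x u) = ev2 id p (re0 x) (re0 u)"
  by (induction p) (simp_all only: ev_cst ev_id re0_ev1 ev1_id dual_parts)

lemma re0_ev3: "re0 (ev3 cst p x u y) = ev3 id p (re0 x) (re0 u) (re0 y)"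
  by (induction p) (simp_all only: ev_cst ev_id re0_ev2 dual_parts)

lemma re1_ev1: "re1 (ev1 cst p x) = poly (pderiv p) (re0 x) * re1 x"
proof (induction p)
  case (pCons c p)
  then show ?case
    by (simp add: ev_cst re0_ev1 pderiv_pCons algebra_simps)
qed (simp add: ev_cst)

lemma analytic_poly:
  "g analytic_on S \<Longrightarrow> (\<lambda>s. poly p (g s)) analytic_on S"
  by (induction p) (auto intro!: analytic_intros)

lemma analytic_ev2:
  "g analytic_on S \<Longrightarrow> h analytic_on S \<Longrightarrow> (\<lambda>s. ev2 id p (g s) (h s)) analytic_on S"
  by (induction p) (simp_all only: ev_id ev1_id analytic_on_const analytic_poly analytic_on_add analytic_on_mult)

lemma analytic_ev3:
  "g analytic_on S \<Longrightarrow> h analytic_on S \<Longrightarrow> k analytic_on S \<Longrightarrow>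
    (\<lambda>s. ev3 id p (g s) (h s) (k s)) analytic_on S"
  by (induction p) (simp_all only: ev_id analytic_on_const analytic_ev2 analytic_on_add analytic_on_mult)

section \<open>Zeros of the quartic on the coordinate lines\<close>

lemma quartic_eval_scale: "quartic_eval id f (scale_quad c q) = c ^ 4 * quartic_eval id f q"
proof (cases q)
  case (fields x y z w)
  have "c ^ 4 = c ^ i * c ^ j * c ^ k * c ^ l" if "i + j + k + l = 4" for i j k l :: nat
    by (simp add: that flip: power_add)
  then show ?thesis
    by (auto simp: fields sum_distrib_left quartic_exponents_def power_mult_distrib
        intro!: sum.cong)
qed

lemma proj_pt_eqD:
  assumes "proj_pt q = proj_pt q'"
  shows "\<exists>c. c \<noteq> 0 \<and> q = scale_quad c q'"
proof -
  have "scale_quad 1 q = q" by (cases q) simp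
  then have "q \<in> proj_pt q"
    unfolding proj_pt_def by (metis (mono_tags, lifting) mem_Collect_eq zero_neq_one)
  then show ?thesis using assms by (auto simp: proj_pt_def)
qed

lemma proj_pt_scale:
  assumes "c \<noteq> 0"
  shows "proj_pt (scale_quad c q) = proj_pt q"
proof -
  have comp: "scale_quad d (scale_quad e q) = scale_quad (d * e) q" for d e :: complex
    by (cases q) (simp add: mult.assoc)
  show ?thesis
  proof
    show "proj_pt (scale_quad c q) \<subseteq> proj_pt q"
      using assms by (auto simp: proj_pt_def comp)
    have "scale_quad d q \<in> proj_pt (scale_quad c q)" if "d \<noteq> 0" for d
      using that assms comp[of "d / c" c]
      unfolding proj_pt_def by (intro CollectI exI[of _ "d / c"]) simp
    then show "proj_pt q \<subseteq> proj_pt (scale_quad c q)"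
      by (auto simp: proj_pt_def)
  qed
qed

lemma zero_locusD:
  assumes "proj_pt q \<in> zero_locus f"
  shows "quartic_eval id f q = 0"
proof -
  obtain q' where q': "proj_pt q = proj_pt q'" "quartic_eval id f q' = 0"
    using assms by (auto simp: zero_locus_def)
  obtain c where "q = scale_quad c q'" using proj_pt_eqD[OF q'(1)] by blast
  then show ?thesis by (simp add: quartic_eval_scale q'(2))
qed

lemma coord_linesI:
  assumes "(x, y, z, w) \<noteq> (0, 0, 0, 0)"
    and "x = 0 \<and> y = 0 \<or> x = 0 \<and> z = 0 \<or> x = 0 \<and> w = 0 \<or>
      y = 0 \<and> z = 0 \<or> y = 0 \<and> w = 0 \<or> z = 0 \<and> w = 0"
  shows "proj_pt (x, y, z, w) \<in> coord_lines"
  unfolding coord_lines_def using assms by blast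

lemma zero_locusI:
  assumes "q \<noteq> (0, 0, 0, 0)" "quartic_eval id f q = 0"
  shows "proj_pt q \<in> zero_locus f"
  unfolding zero_locus_def using assms by blast

lemma quartic_nonzero_at_fixed_pts:
  assumes "torus_fixed_pts \<inter> sing_pts f = {}"
  shows "quartic_eval id f (1, 0, 0, 0) \<noteq> 0" "quartic_eval id f (0, 1, 0, 0) \<noteq> 0"
    "quartic_eval id f (0, 0, 1, 0) \<noteq> 0" "quartic_eval id f (0, 0, 0, 1) \<noteq> 0"
proof -
  have *: "quartic_eval id f q \<noteq> 0" if "proj_pt q \<in> torus_fixed_pts" "proj_pt q \<in> coord_lines"
      "q \<noteq> (0, 0, 0, 0)" for q
    using that assms zero_locusI[of q f] unfolding sing_pts_def by blast
  show "quartic_eval id f (1, 0, 0, 0) \<noteq> 0" "quartic_eval id f (0, 1, 0, 0) \<noteq> 0"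
    "quartic_eval id f (0, 0, 1, 0) \<noteq> 0" "quartic_eval id f (0, 0, 0, 1) \<noteq> 0"
    by (intro * coord_linesI; simp add: torus_fixed_pts_def)+
qed

lemma quartic_vanishes_at_nodes:
  assumes "a \<noteq> 0" "the_line a b \<inter> coord_lines \<subseteq> sing_pts f"
  shows "quartic_eval id f (hom_coords P 0 (alpha a b P) 0) = 0"
proof -
  have line: "proj_pt (x, y, z, w) \<in> the_line a b"
    if "(x, y, z, w) \<noteq> (0, 0, 0, 0)" "x + a * z + b * w = 0" "y = 0" for x y z w
    unfolding the_line_def using that by blast
  have "proj_pt (hom_coords P 0 (alpha a b P) 0) \<in> coord_lines"
    by (cases P) (simp_all add: coord_linesI)
  moreover have "proj_pt (hom_coords P 0 (alpha a b P) 0) \<in> the_line a b"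
    using assms(1) by (cases P) (simp_all add: line)
  ultimately show ?thesis
    using assms(2) by (intro zero_locusD) (auto simp: sing_pts_def)
qed

text \<open>The six coordinate lines, each without one torus fixed point; the value \<open>v = 0\<close> gives the other
  one. The first three are the lines \<open>v \<mapsto> hom_coords P 0 v 0\<close> through the marked points, in the
  same parametrisation.\<close>

fun line_quad :: "nat \<Rightarrow> 'a \<Rightarrow> 'a::comm_ring_1 quad" where
  "line_quad 0 v = (0, 0, v, 1)"
| "line_quad (Suc 0) v = (v, 0, 0, 1)"
| "line_quad (Suc (Suc 0)) v = (1, 0, v, 0)"
| "line_quad (Suc (Suc (Suc 0))) v = (0, v, 0, 1)"
| "line_quad (Suc (Suc (Suc (Suc 0)))) v = (0, v, 1, 0)"
| "line_quad _ v = (v, 1, 0, 0)"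

definition line_poly :: "quartic \<Rightarrow> nat \<Rightarrow> complex poly" where
  "line_poly f i = quartic_eval (\<lambda>c. [:c:]) f (line_quad i [:0, 1:])"

lemma poly_line_poly: "poly (line_poly f i) v = quartic_eval id f (line_quad i v)"
  by (cases "(i, v)" rule: line_quad.cases) (simp_all add: line_poly_def poly_sum case_prod_unfold mult.assoc)

lemma finite_quartic_exponents: "finite quartic_exponents"
  by (rule finite_subset[of _ "{..4} \<times> {..4} \<times> {..4} \<times> {..4}"])
    (auto simp: quartic_exponents_def)

lemma degree_quartic_eval_le:
  fixes X :: "complex poly"
  assumes "degree X \<le> 1" "degree Y \<le> 1" "degree Z \<le> 1" "degree W \<le> 1"
  shows "degree (quartic_eval (\<lambda>c. [:c:]) f (X, Y, Z, W)) \<le> 4"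
proof -
  have pow: "degree (V ^ n) \<le> n" if "degree V \<le> 1" for V :: "complex poly" and n
    using degree_power_le[of V n] that
    by (metis le_trans mult.commute mult_le_mono2 nat_mult_1_right)
  have prod: "degree (A * B) \<le> m + n" if "degree A \<le> m" "degree B \<le> n" for A B :: "complex poly" and m n
    using degree_mult_le[of A B] that by linarith
  have "degree ([:c:] * X ^ i * Y ^ j * Z ^ k * W ^ l) \<le> 0 + i + j + k + l" for c i j k l
    by (intro prod pow assms) simp
  then have "degree ([:c:] * X ^ i * Y ^ j * Z ^ k * W ^ l) \<le> 4" if "i + j + k + l = 4" for c i j k l
    using that by (metis add_0)
  then show ?thesis
    unfolding quartic_eval.simps
    by (intro degree_sum_le) (auto simp: quartic_exponents_def finite_quartic_exponents[unfolded quartic_exponents_def])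
qed

fun node_line :: "node \<Rightarrow> nat" where
  "node_line Px = 0" | "node_line Pz = 1" | "node_line Pw = 2"

lemma line_quad_node_line: "line_quad (node_line P) v = hom_coords P 0 v 0"
  by (cases P) (simp_all add: numeral_2_eq_2)

lemma degree_line_poly_le: "degree (line_poly f i) \<le> 4"
  unfolding line_poly_def
  by (cases "(i, 0 :: complex)" rule: line_quad.cases)
    (simp_all only: prod.inject line_quad.simps, (rule degree_quartic_eval_le; simp)+)

lemma card_roots_le_3:
  fixes p q :: "complex poly"
  assumes "p \<noteq> 0" "degree p \<le> 4" "\<And>v. poly p v = (v - c)\<^sup>2 * poly q (v - c)"
  shows "card {v. poly p v = 0} \<le> 3"
proof -
  define q' where "q' = pcompose q [:- c, 1:]"
  have p: "p = [:- c, 1:]\<^sup>2 * q'"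
    by (simp add: poly_eq_poly_eq_iff[symmetric] fun_eq_iff assms(3) q'_def poly_pcompose
        algebra_simps)
  then have "q' \<noteq> 0" using assms(1) by auto
  then have "degree p = 2 + degree q'"
    by (simp add: p degree_mult_eq degree_power_eq del: mult_pCons_left)
  then have "card {v. poly q' v = 0} \<le> 2"
    using card_poly_roots_bound[OF \<open>q' \<noteq> 0\<close>] assms(2) by linarith
  moreover have "card {v. poly p v = 0} \<le> card (insert c {v. poly q' v = 0})"
    using poly_roots_finite[OF \<open>q' \<noteq> 0\<close>] by (intro card_mono) (auto simp: p)
  ultimately show ?thesis
    using card_insert_le_m1[of 3 "{v. poly q' v = 0}" c] by simp
qed

text \<open>If \<open>f\<^sub>1(0) = 0\<close>, then \<open>v' f\<^sub>1(v')\<close> is divisible by \<open>v'\<^sup>2\<close>, so that the quartic has a multiple zero on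
  one coordinate line and at most three zeros there. With at most four on each of the other five
  lines this gives at most 23 singular points. The quartic does not vanish identically on any
  coordinate line, since each line contains a torus fixed point and these are not zeros.\<close>

lemma loc_f1_nonzero:
  assumes "card (sing_pts f) = 24" "torus_fixed_pts \<inter> sing_pts f = {}"
    and zero: "quartic_eval id f (hom_coords P 0 (alpha a b P) 0) = 0"
  shows "poly (loc_f1 f a b P) 0 \<noteq> 0"
proof
  assume "poly (loc_f1 f a b P) 0 = 0"
  then obtain q where q: "loc_f1 f a b P = [:0, 1:] * q"
    by (auto simp: poly_eq_0_iff_dvd elim: dvdE)
  note nz = quartic_nonzero_at_fixed_pts[OF assms(2)]
  let ?R = "\<lambda>i. {v. poly (line_poly f i) v = 0}"
  let ?S = "\<lambda>i. (\<lambda>v. proj_pt (line_quad i v)) ` ?R i"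
  have p_nz: "line_poly f i \<noteq> 0" for i
  proof -
    have "poly (line_poly f i) 0 \<noteq> 0"
      unfolding poly_line_poly using nz
      by (cases "(i, 0 :: complex)" rule: line_quad.cases) (simp_all del: quartic_eval.simps)
    then show ?thesis by auto
  qed
  have cover: "sing_pts f \<subseteq> (\<Union>i<6. ?S i)"
  proof
    fix A assume A: "A \<in> sing_pts f"
    then obtain x y z w where q: "A = proj_pt (x, y, z, w)" "(x, y, z, w) \<noteq> (0, 0, 0, 0)"
      and cases: "x = 0 \<and> y = 0 \<or> x = 0 \<and> z = 0 \<or> x = 0 \<and> w = 0 \<or>
        y = 0 \<and> z = 0 \<or> y = 0 \<and> w = 0 \<or> z = 0 \<and> w = 0"
      unfolding sing_pts_def coord_lines_def by blast
    have f0: "quartic_eval id f (x, y, z, w) = 0"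
      using A q zero_locusD unfolding sing_pts_def by blast
    have vertex: False if "(x, y, z, w) = scale_quad c e" "quartic_eval id f e \<noteq> 0" for c e
      using f0 q(2) that quartic_eval_scale[of f c e] by (cases e; cases "c = 0") auto
    have on_line: "A \<in> (\<Union>i<6. ?S i)"
      if "(x, y, z, w) = scale_quad c (line_quad i v)" "c \<noteq> 0" "i < 6" for c i v
    proof -
      have "poly (line_poly f i) v = 0"
        using f0 that quartic_eval_scale[of f c "line_quad i v"] by (simp add: poly_line_poly)
      moreover have "A = proj_pt (line_quad i v)"
        using q(1) that proj_pt_scale by metis
      ultimately show ?thesis using that(3) by blast
    qed
    consider "x = 0" "y = 0" | "x = 0" "z = 0" | "x = 0" "w = 0" | "y = 0" "z = 0" |
      "y = 0" "w = 0" | "z = 0" "w = 0" using cases by blast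
    then show "A \<in> (\<Union>i<6. ?S i)"
    proof cases
      case 1
      then show ?thesis
        using on_line[of w 0 "z / w"] vertex[OF _ nz(3), of z] by (cases "w = 0") auto
    next
      case 2
      then show ?thesis
        using on_line[of w "Suc (Suc (Suc 0))" "y / w"] vertex[OF _ nz(2), of y] by (cases "w = 0") auto
    next
      case 3
      then show ?thesis
        using on_line[of z "Suc (Suc (Suc (Suc 0)))" "y / z"] vertex[OF _ nz(2), of y] by (cases "z = 0") auto
    next
      case 4
      then show ?thesis
        using on_line[of w "Suc 0" "x / w"] vertex[OF _ nz(1), of x] by (cases "w = 0") auto
    next
      case 5
      then show ?thesis
        using on_line[of x "Suc (Suc 0)" "z / x"] vertex[OF _ nz(3), of z] by (cases "x = 0") auto
    next
      case 6
      then show ?thesis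
        using on_line[of y "Suc (Suc (Suc (Suc (Suc 0))))" "x / y"] vertex[OF _ nz(1), of x] by (cases "y = 0") auto
    qed
  qed
  have fin: "finite (?R i)" for i
    using p_nz by (rule poly_roots_finite)
  have card_R: "card (?R i) \<le> 4" for i
    using card_poly_roots_bound[OF p_nz, of i] degree_line_poly_le[of f i] by linarith
  have card_R': "card (?R (node_line P)) \<le> 3"
  proof (rule card_roots_le_3[OF p_nz degree_line_poly_le])
    fix v
    have "poly (line_poly f (node_line P)) v =
        quartic_eval id f (hom_coords P 0 ((v - alpha a b P) + id (alpha a b P)) 0)"
      by (simp add: poly_line_poly line_quad_node_line)
    also have "\<dots> = (v - alpha a b P) * ev1 id (loc_f1 f a b P) (v - alpha a b P)"
      by (subst local_decomposition[OF id_hom zero]) simp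
    finally show "poly (line_poly f (node_line P)) v =
        (v - alpha a b P)\<^sup>2 * poly q (v - alpha a b P)"
      by (simp add: ev1_id q power2_eq_square)
  qed
  have node: "node_line P < 6" by (cases P) simp_all
  have "card (sing_pts f) \<le> card (\<Union>i<6. ?S i)"
    using fin cover by (intro card_mono) auto
  also have "\<dots> \<le> (\<Sum>i<6. card (?S i))"
    by (rule card_UN_le) simp
  also have "\<dots> \<le> (\<Sum>i<6. card (?R i))"
    using fin by (intro sum_mono card_image_le)
  also have "\<dots> = card (?R (node_line P)) + (\<Sum>i\<in>{..<6} - {node_line P}. card (?R i))"
    using node by (intro sum.remove) auto
  also have "\<dots> \<le> 3 + (\<Sum>i\<in>{..<6} - {node_line P}. 4)"
    using card_R card_R' by (intro add_mono sum_mono)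
  also have "\<dots> = 23" using node by simp
  finally show False using assms(1) by simp
qed

section \<open>The log condition at a marked point\<close>

lemma re0_val_f4: "re0 (val_f4 cst f a b P v u y) = val_f4 id f a b P (re0 v) (re0 u) (re0 y)"
  by (simp only: val_f4_def dual_parts re0_ev3 id_apply)

lemma re0_val_f5: "re0 (val_f5 cst f a b P v u y) = val_f5 id f a b P (re0 v) (re0 u) (re0 y)"
  by (simp only: val_f5_def dual_parts re0_ev3 re0_ev2 id_apply)

lemma fun_XYZ_parts:
  fixes f a b P q
  defines "u \<equiv> coord_u P q" and "v \<equiv> coord_v P q" and "y \<equiv> coord_y P q"
    and "w \<equiv> re0 (coord_v P q) - alpha a b P"
  shows "re0 (fun_X f a b P q) = re0 u"
    and "re1 (fun_X f a b P q) = re1 u + val_f4 id f a b P w (re0 u) (re0 y)"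
    and "re0 (fun_Y f a b P q) = re0 y * re0 v"
    and "re1 (fun_Y f a b P q) =
      re0 y * re1 v + re1 y * re0 v + ev2 id (loc_f2 f a b P) w (re0 u)"
    and "re0 (fun_Z f a b P q) = w * poly (loc_f1 f a b P) w"
    and "re1 (fun_Z f a b P q) =
      re1 v * (poly (loc_f1 f a b P) w + w * poly (pderiv (loc_f1 f a b P)) w) +
      val_f5 id f a b P w (re0 u) (re0 y)"
  unfolding assms fun_X_def fun_Y_def fun_Z_def Let_def
  by (simp_all only: dual_parts re0_val_f4 re0_val_f5 re0_ev2 re0_ev1 re1_ev1)
    (simp_all add: algebra_simps)

lemma analytic_factor:
  fixes \<phi> :: "complex \<Rightarrow> complex"
  assumes "\<phi> analytic_on {p}" "\<phi> p = 0"
  shows "\<exists>\<psi>. \<psi> analytic_on {p} \<and> (\<forall>s. \<phi> s = (s - p) * \<psi> s)"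
proof -
  obtain r where r: "r > 0" "\<phi> holomorphic_on ball p r"
    using assms(1) analytic_at_ball by blast
  define \<psi> where "\<psi> = (\<lambda>s. if s = p then deriv \<phi> p else (\<phi> s - \<phi> p) / (s - p))"
  have "\<psi> holomorphic_on ball p r"
    unfolding \<psi>_def using r by (intro pole_lemma) auto
  then have "\<psi> analytic_on {p}"
    using r(1) analytic_at centre_in_ball open_ball by blast
  moreover have "\<phi> s = (s - p) * \<psi> s" for s
    using assms(2) by (simp add: \<psi>_def)
  ultimately show ?thesis by blast
qed

lemma kappa_nonzero: "a \<noteq> 0 \<Longrightarrow> b \<noteq> 0 \<Longrightarrow> kappa a b P \<noteq> 0"
  and alpha_nonzero: "a \<noteq> 0 \<Longrightarrow> b \<noteq> 0 \<Longrightarrow> alpha a b P \<noteq> 0"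
  by (cases P; simp)+

text \<open>To first order at the marked point, \<open>X = u + t f\<^sub>4\<close> and \<open>Z = v' f\<^sub>1 + t f\<^sub>5\<close> only involve the
  \<open>t\<close>-coefficients of \<open>u\<close> and \<open>v\<close>, and \<open>b\<^sub>1 = \<kappa> f\<^sub>4(0) - f\<^sub>5(0) / f\<^sub>1(0)\<close> is \<open>v\<^sub>1 - \<kappa> u\<^sub>1\<close> for the
  solution of \<open>X = Z = 0\<close>.\<close>

lemma fun_X_Z_zero_iff:
  assumes "re0 (coord_u P q) = 0" "re0 (coord_v P q) = alpha a b P" "re0 (coord_y P q) = 0"
    and "poly (loc_f1 f a b P) 0 \<noteq> 0"
  shows "fun_X f a b P q = 0 \<and> fun_Z f a b P q = 0 \<longleftrightarrow>
    re1 (coord_u P q) = - val_f4 id f a b P 0 0 0 \<and>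
    re1 (coord_v P q) - kappa a b P * re1 (coord_u P q) = b1 f a b P"
proof -
  let ?f4 = "val_f4 id f a b P 0 0 0" and ?f5 = "val_f5 id f a b P 0 0 0"
    and ?f1 = "poly (loc_f1 f a b P) 0"
  have "fun_X f a b P q = 0 \<longleftrightarrow> re1 (coord_u P q) + ?f4 = 0"
    using assms(1-3) by (simp add: dual_eq_iff fun_XYZ_parts)
  moreover have "fun_Z f a b P q = 0 \<longleftrightarrow> re1 (coord_v P q) = - (?f5 / ?f1)"
  proof -
    have "fun_Z f a b P q = 0 \<longleftrightarrow> re1 (coord_v P q) * ?f1 + ?f5 = 0"
      using assms(1-3) by (simp add: dual_eq_iff fun_XYZ_parts)
    also have "\<dots> \<longleftrightarrow> re1 (coord_v P q) * ?f1 = - ?f5"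
      by (rule eq_neg_iff_add_eq_0[symmetric])
    also have "\<dots> \<longleftrightarrow> re1 (coord_v P q) = - (?f5 / ?f1)"
      using assms(4) by (metis eq_divide_eq minus_divide_left)
    finally show ?thesis .
  qed
  moreover have "b1 f a b P = kappa a b P * ?f4 - ?f5 / ?f1"
    using assms(4) by (simp add: b1_def Let_def diff_divide_distrib)
  ultimately show ?thesis
    by (auto simp: eq_neg_iff_add_eq_0[symmetric])
qed

text \<open>The sections over \<open>X\<close> and \<open>Z\<close> have ghost image \<open>\<tau>\<^sub>S\<close>, so that \<open>X\<close> and \<open>Z\<close> are multiples of the
  local parameter \<open>s - p\<close>.\<close>

lemma log_lift_at_zero:
  assumes "log_lift_at f a b P p F"
  shows "fun_X f a b P (F p) = 0" "fun_Z f a b P (F p) = 0"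
proof -
  have zero: "log_struct_map p m p = 0" if "ord_S m = 1" for m
    using that by (simp add: log_struct_map_def cst_hom)
  obtain mX mZ where "ord_S mX = 1" "ord_S mZ = 1"
      and "\<forall>\<^sub>F s in nhds p. log_struct_map p mX s = fun_X f a b P (F s)"
      and "\<forall>\<^sub>F s in nhds p. log_struct_map p mZ s = fun_Z f a b P (F s)"
    using assms unfolding log_lift_at_def by auto
  then show "fun_X f a b P (F p) = 0" "fun_Z f a b P (F p) = 0"
    using eventually_nhds_x_imp_x zero by fastforce+
qed

text \<open>Converse of \<open>log_lift_at_zero\<close> for a deformation of the line in the total space. Here \<open>k\<close> is
  \<open>u / (s - p)\<close> modulo \<open>t\<close>. Modulo \<open>t\<close> the unit parts of \<open>mX\<close>, \<open>mZ\<close>, \<open>mY\<close> are \<open>k\<close>,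
  \<open>k h\<close> and \<open>- h\<close> with \<open>h = \<kappa> f\<^sub>1(\<kappa> u)\<close>, since \<open>v' = \<kappa> u\<close> along the line. The
  \<open>t\<close>-coefficients for \<open>mX\<close> and \<open>mZ\<close> come from dividing by \<open>s - p\<close>. The structure map kills the
  one for \<open>mY\<close>, and the relation between the sections determines it.\<close>

lemma log_lift_atI:
  fixes F f P a b p k
  defines "u \<equiv> \<lambda>s. coord_u P (F s)" and "v \<equiv> \<lambda>s. coord_v P (F s)" and "y \<equiv> \<lambda>s. coord_y P (F s)"
  assumes ab: "a \<noteq> 0" "b \<noteq> 0"
    and f1: "poly (loc_f1 f a b P) 0 \<noteq> 0"
    and zero: "quartic_eval id f (hom_coords P 0 (alpha a b P) 0) = 0"
    and an: "dual_analytic_at u p" "dual_analytic_at v p" "dual_analytic_at y p"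
    and k: "k analytic_on {p}" "k p \<noteq> 0"
    and line: "\<forall>\<^sub>F s in nhds p. re0 (u s) = (s - p) * k s \<and>
      re0 (v s) = kappa a b P * re0 (u s) + alpha a b P \<and> re0 (y s) = 0"
    and total: "\<forall>\<^sub>F s in nhds p. re0 (u s) * re0 (v s) * re1 (y s) +
      quartic_eval id f (hom_coords P (re0 (u s)) (re0 (v s)) 0) = 0"
    and XZ: "fun_X f a b P (F p) = 0" "fun_Z f a b P (F p) = 0"
  shows "log_lift_at f a b P p F"
proof -
  let ?\<kappa> = "kappa a b P" and ?\<alpha> = "alpha a b P" and ?f1 = "poly (loc_f1 f a b P)"
  have coords: "coord_u P (F s) = u s" "coord_v P (F s) = v s" "coord_y P (F s) = y s" for s
    by (simp_all add: u_def v_def y_def)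
  note parts = fun_XYZ_parts[of f a b P "F s" for s, unfolded coords]
  have uvy: "(\<lambda>s. re0 (u s)) analytic_on {p}" "(\<lambda>s. re1 (u s)) analytic_on {p}"
    "(\<lambda>s. re0 (v s)) analytic_on {p}" "(\<lambda>s. re1 (v s)) analytic_on {p}"
    "(\<lambda>s. re0 (y s)) analytic_on {p}" "(\<lambda>s. re1 (y s)) analytic_on {p}"
    using an by (auto simp: dual_analytic_at_def)
  have vp: "re0 (v p) \<noteq> 0"
    using eventually_nhds_x_imp_x[OF line] alpha_nonzero[OF ab] by simp
  have X1: "(\<lambda>s. re1 (fun_X f a b P (F s))) analytic_on {p}"
    unfolding parts val_f4_def using uvy vp
    by (intro analytic_intros analytic_ev3) auto
  have Y1: "(\<lambda>s. re1 (fun_Y f a b P (F s))) analytic_on {p}"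
    unfolding parts using uvy vp
    by (intro analytic_intros analytic_ev2) auto
  have Z1: "(\<lambda>s. re1 (fun_Z f a b P (F s))) analytic_on {p}"
    unfolding parts val_f5_def using uvy vp
    by (intro analytic_intros analytic_ev3 analytic_ev2 analytic_poly) auto
  obtain gX where gX: "gX analytic_on {p}" "\<And>s. re1 (fun_X f a b P (F s)) = (s - p) * gX s"
    using analytic_factor[OF X1] XZ by auto
  obtain gZ where gZ: "gZ analytic_on {p}" "\<And>s. re1 (fun_Z f a b P (F s)) = (s - p) * gZ s"
    using analytic_factor[OF Z1] XZ by auto
  define h where "h = (\<lambda>s. ?\<kappa> * ?f1 (?\<kappa> * ((s - p) * k s)))"
  have h: "h analytic_on {p}"
    unfolding h_def using k by (intro analytic_intros analytic_poly) auto
  have h_p: "h p \<noteq> 0"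
    using f1 kappa_nonzero[OF ab] by (simp add: h_def)
  have "isCont k p" using k(1) by (rule analytic_at_imp_isCont)
  then have "\<forall>\<^sub>F s in at p. k s \<noteq> 0"
    using k(2) by (intro tendsto_imp_eventually_ne) (auto simp: isCont_def)
  then have k_nz: "\<forall>\<^sub>F s in nhds p. k s \<noteq> 0"
    using k(2) by (simp add: eventually_nhds_conv_at)
  \<comment> \<open>The \<open>t\<close>-coefficient of the total space equation is \<open>u (Y\<^sub>1 + h) = 0\<close>. It determines \<open>Y\<^sub>1\<close>
      where \<open>u \<noteq> 0\<close>, and continuity gives the value at \<open>p\<close>.\<close>
  have "\<forall>\<^sub>F s in at p. re1 (fun_Y f a b P (F s)) = - h s"
  proof -
    have "\<forall>\<^sub>F s in at p. (re0 (u s) = (s - p) * k s \<and>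
      re0 (v s) = kappa a b P * re0 (u s) + alpha a b P \<and> re0 (y s) = 0) \<and>
      re0 (u s) * re0 (v s) * re1 (y s) +
      quartic_eval id f (hom_coords P (re0 (u s)) (re0 (v s)) 0) = 0 \<and> k s \<noteq> 0 \<and> s \<noteq> p"
      using line total k_nz
      by (auto simp: eventually_nhds_conv_at eventually_conj_iff eventually_neq_at_within)
    then show ?thesis
    proof eventually_elim
      case (elim s)
      let ?u = "re0 (u s)"
      have w: "re0 (v s) - ?\<alpha> = ?\<kappa> * ?u" and u0: "?u \<noteq> 0" and y0: "re0 (y s) = 0"
        using elim by auto
      let ?f1u = "?f1 (?\<kappa> * ?u)" and ?f2u = "ev2 id (loc_f2 f a b P) (?\<kappa> * ?u) ?u"
      have "quartic_eval id f (hom_coords P ?u (?\<kappa> * ?u + id ?\<alpha>) 0) =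
          ?\<kappa> * ?u * ev1 id (loc_f1 f a b P) (?\<kappa> * ?u) + ?u * ?f2u +
          0 * ev3 id (loc_f3 f a b P) (?\<kappa> * ?u) ?u 0"
        by (rule local_decomposition[OF id_hom zero])
      then have "quartic_eval id f (hom_coords P ?u (re0 (v s)) 0) =
          ?\<kappa> * ?u * ?f1u + ?u * ?f2u"
        using elim by (simp only: ev1_id id_apply mult_zero_left add_0_right)
      then have "?u * re0 (v s) * re1 (y s) + (?\<kappa> * ?u * ?f1u + ?u * ?f2u) = 0"
        using elim by argo
      then have "?u * (re1 (fun_Y f a b P (F s)) + ?\<kappa> * ?f1u) = 0"
        unfolding parts w y0 by (simp only: mult_zero_left add_0 algebra_simps)
      then have "re1 (fun_Y f a b P (F s)) = - (?\<kappa> * ?f1u)"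
        using u0 by (simp add: add_eq_0_iff2)
      then show ?case using elim by (simp add: h_def)
    qed
  qed
  moreover have "re1 (fun_Y f a b P (F p)) = - h p"
  proof (rule tendsto_unique)
    show "((\<lambda>s. - h s) \<longlongrightarrow> - h p) (at p)"
      using analytic_at_imp_isCont[OF h] by (intro tendsto_minus) (simp add: isCont_def)
    show "((\<lambda>s. - h s) \<longlongrightarrow> re1 (fun_Y f a b P (F p))) (at p)"
      using analytic_at_imp_isCont[OF Y1] calculation
      by (auto simp: isCont_def elim: tendsto_cong[THEN iffD1, rotated])
  qed simp
  ultimately have Y: "\<forall>\<^sub>F s in nhds p. re1 (fun_Y f a b P (F s)) = - h s"
    by (simp add: eventually_nhds_conv_at)
  define mX where "mX = LogSec (\<lambda>s. Dual (k s) (gX s)) 1 0"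
  define mY where "mY = LogSec (\<lambda>s. Dual (- h s) ((gX s * h s - gZ s) / k s)) 0 1"
  define mZ where "mZ = LogSec (\<lambda>s. Dual (k s * h s) (gZ s)) 1 0"
  show ?thesis
    unfolding log_lift_at_def
  proof (rule exI[of _ mX], rule exI[of _ mY], rule exI[of _ mZ], rule exI[of _ log_tau_t],
      intro conjI)
    show "\<forall>m\<in>{mX, mY, mZ, log_tau_t}. log_germ_at p m"
      using k h h_p gX(1) gZ(1)
      by (auto simp: log_germ_at_def dual_analytic_at_def mX_def mY_def mZ_def log_tau_t_def
          intro!: analytic_intros)
    show "\<forall>\<^sub>F s in nhds p. log_struct_map p mX s = fun_X f a b P (F s)"
      using line by eventually_elim
        (simp add: dual_eq_iff log_struct_map_def mX_def gX(2) parts(1) mult.commute)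
    show "\<forall>\<^sub>F s in nhds p. log_struct_map p mY s = fun_Y f a b P (F s)"
      using line Y by eventually_elim
        (simp add: dual_eq_iff log_struct_map_def mY_def parts(3))
    show "\<forall>\<^sub>F s in nhds p. log_struct_map p mZ s = fun_Z f a b P (F s)"
      using line by eventually_elim
        (simp add: dual_eq_iff log_struct_map_def mZ_def h_def gZ(2) parts(5) mult.commute)
    show "\<forall>\<^sub>F s in nhds p. log_struct_map p log_tau_t s = tt"
      by (simp add: log_struct_map_def log_tau_t_def)
    show "log_germ_eq p (log_mult mX mY) (log_mult (log_unit (- 1)) (log_mult log_tau_t mZ))"
      using k_nz unfolding log_germ_eq_def
      by (auto simp: log_mult_def log_unit_def log_tau_t_def mX_def mY_def mZ_def dual_eq_iff
          elim!: eventually_mono)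
    show "log_germ_eq p log_tau_t log_tau_t"
      by (simp add: log_germ_eq_def)
  qed (simp_all add: mX_def mY_def mZ_def)
qed

section \<open>The normal displacement of a first order deformation\<close>

fun normal_part :: "complex \<Rightarrow> complex \<Rightarrow> dual quad \<Rightarrow> complex" where
  "normal_part a b (x, y, z, w) = re1 x + a * re1 z + b * re1 w"

fun node_quad :: "complex \<Rightarrow> complex \<Rightarrow> node \<Rightarrow> complex quad" where
  "node_quad a b Px = phi0 a b (- b / a) 1"
| "node_quad a b Pz = phi0 a b 0 1"
| "node_quad a b Pw = phi0 a b 1 0"

fun node_weight :: "complex \<Rightarrow> node \<Rightarrow> complex" where
  "node_weight a Px = a" | "node_weight a Pz = 1" | "node_weight a Pw = - a\<^sup>2"

text \<open>Passing from homogeneous to local coordinates: \<open>x + a z + b w\<close> is \<open>a w (v' - \<kappa> u)\<close> at \<open>Px\<close>,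
  \<open>w (v' - \<kappa> u)\<close> at \<open>Pz\<close> and \<open>a x (v' - \<kappa> u)\<close> at \<open>Pw\<close>. On \<open>node_quad\<close> the factors \<open>w\<close>
  and \<open>x\<close> are \<open>1\<close>, \<open>1\<close> and \<open>- a\<close>; this explains \<open>node_weight\<close>.\<close>

lemma coords_at_node:
  assumes a: "a \<noteq> 0" and c: "c \<noteq> 0" and red: "reduce_quad q = scale_quad c (node_quad a b P)"
  shows "re0 (coord_u P q) = 0" "re0 (coord_v P q) = alpha a b P" "re0 (coord_y P q) = 0"
    and "normal_part a b q =
      node_weight a P * c * (re1 (coord_v P q) - kappa a b P * re1 (coord_u P q))"
proof -
  obtain x y z w where q: "q = (x, y, z, w)" by (cases q)
  have "re0 (coord_u P q) = 0 \<and> re0 (coord_v P q) = alpha a b P \<and> re0 (coord_y P q) = 0 \<and>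
    normal_part a b q =
      node_weight a P * c * (re1 (coord_v P q) - kappa a b P * re1 (coord_u P q))"
  proof (cases P)
    case Px
    then have r: "re0 x = 0" "re0 y = 0" "re0 z = c * (- b / a)" "re0 w = c"
      using red a by (simp_all add: q phi0_def)
    show ?thesis
      unfolding Px q coord_u.simps coord_v.simps coord_y.simps normal_part.simps dual_parts r
      using a c by (simp add: field_simps power2_eq_square)
  next
    case Pz
    then have r: "re0 x = c * (- b)" "re0 y = 0" "re0 z = 0" "re0 w = c"
      using red by (simp_all add: q phi0_def)
    show ?thesis
      unfolding Pz q coord_u.simps coord_v.simps coord_y.simps normal_part.simps dual_parts r
      using a c by (simp add: field_simps power2_eq_square)
  next
    case Pw
    then have r: "re0 x = c * (- a)" "re0 y = 0" "re0 z = c" "re0 w = 0"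
      using red by (simp_all add: q phi0_def)
    show ?thesis
      unfolding Pw q coord_u.simps coord_v.simps coord_y.simps normal_part.simps dual_parts r
      using a c by (simp add: field_simps power2_eq_square)
  qed
  then show "re0 (coord_u P q) = 0" "re0 (coord_v P q) = alpha a b P" "re0 (coord_y P q) = 0"
    and "normal_part a b q =
      node_weight a P * c * (re1 (coord_v P q) - kappa a b P * re1 (coord_u P q))"
    by blast+
qed

lemma normal_part_scale:
  assumes "reduce_quad q = scale_quad d (phi0 a b s r)"
  shows "normal_part a b (scale_quad c q) = re0 c * normal_part a b q"
proof -
  obtain x y z w where q: "q = (x, y, z, w)" by (cases q)
  have "normal_part a b (scale_quad c q) =
      re0 c * normal_part a b q + re1 c * (re0 x + a * re0 z + b * re0 w)"
    by (simp add: q algebra_simps)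
  moreover have "re0 x = d * (- a * s - b * r)" "re0 z = d * s" "re0 w = d * r"
    using assms by (simp_all add: q phi0_def)
  then have "re0 x + a * re0 z + b * re0 w = 0"
    by (simp add: right_diff_distrib)
  ultimately show ?thesis by simp
qed

text \<open>A global section of \<open>O(1)\<close>, given on the two charts by \<open>N\<close> and \<open>M\<close>, is a linear form: the
  difference quotient of \<open>N\<close> at \<open>0\<close> is entire and tends to \<open>M 0\<close> at infinity.\<close>

lemma linear_if_simple_pole_at_infinity:
  fixes N M :: "complex \<Rightarrow> complex"
  assumes N: "N holomorphic_on UNIV" and M: "M holomorphic_on UNIV"
    and NM: "\<And>s. s \<noteq> 0 \<Longrightarrow> M (1 / s) = N s / s"
  shows "N s = N 0 + M 0 * s"
proof -
  define D where "D = (\<lambda>s. if s = 0 then deriv N 0 else (N s - N 0) / (s - 0))"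
  have "D holomorphic_on UNIV"
    unfolding D_def using N by (intro pole_lemma) auto
  moreover have "(D \<longlongrightarrow> M 0) at_infinity"
  proof -
    have "isCont M 0"
      using holomorphic_on_imp_continuous_on[OF M] by (simp add: continuous_on_eq_continuous_at)
    then have "((\<lambda>s. M (inverse s) - N 0 * inverse s) \<longlongrightarrow> M 0 - N 0 * 0) at_infinity"
      by (intro tendsto_diff tendsto_mult tendsto_const tendsto_inverse_0 isCont_tendsto_compose[of 0 M])
    moreover have "\<forall>\<^sub>F s in at_infinity. M (inverse s) - N 0 * inverse s = D s"
      using eventually_not_equal_at_infinity[of 0]
    proof eventually_elim
      case (elim s)
      then show ?case
        using NM[OF elim] by (simp add: D_def diff_divide_distrib inverse_eq_divide)
    qed
    ultimately show ?thesis
      by (auto elim: tendsto_cong[THEN iffD1, rotated])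
  qed
  ultimately have "D s = M 0" by (rule Liouville_weak)
  then show ?thesis by (cases "s = 0") (auto simp: D_def field_simps)
qed

lemma lift_imp_relation:
  assumes a: "a \<noteq> 0" and f1: "\<And>P. poly (loc_f1 f a b P) 0 \<noteq> 0"
    and lift: "has_first_order_lift f a b"
  shows "a * b1 f a b Px - a * b * b1 f a b Pw - b1 f a b Pz = 0"
proof -
  obtain F G where FG: "first_order_map f a b F G"
    and logF: "log_lift_at f a b Px (- b / a) (quad_at F)" "log_lift_at f a b Pz 0 (quad_at F)"
    and logG: "log_lift_at f a b Pw 0 (quad_at G)"
    using lift unfolding has_first_order_lift_def by blast
  obtain Fx Fy Fz Fw where F: "F = (Fx, Fy, Fz, Fw)" by (cases F)
  obtain Gx Gy Gz Gw where G: "G = (Gx, Gy, Gz, Gw)" by (cases G)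
  \<comment> \<open>Dividing by \<open>w\<close> on the first chart and by \<open>z\<close> on the second makes the normal part
      independent of the choice of homogeneous coordinates.\<close>
  define N where "N = (\<lambda>s. normal_part a b (quad_at F s) / re0 (Fw s))"
  define M where "M = (\<lambda>r. normal_part a b (quad_at G r) / re0 (Gz r))"
  have redF: "re0 (Fw s) \<noteq> 0 \<and> reduce_quad (quad_at F s) = scale_quad (re0 (Fw s)) (phi0 a b s 1)" for s
    using FG by (force simp: first_order_map_def F phi0_def)
  have redG: "re0 (Gz r) \<noteq> 0 \<and> reduce_quad (quad_at G r) = scale_quad (re0 (Gz r)) (phi0 a b 1 r)" for r
    using FG by (force simp: first_order_map_def G phi0_def)
  have "N holomorphic_on UNIV" "M holomorphic_on UNIV"
    using FG redF redG unfolding N_def M_def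
    by (auto simp: first_order_map_def F G dual_holomorphic_on_def intro!: holomorphic_intros)
  moreover have "M (1 / s) = N s / s" if s: "s \<noteq> 0" for s
  proof -
    obtain c where c: "re0 c \<noteq> 0" "quad_at G (1 / s) = scale_quad c (quad_at F s)"
      using FG s by (auto simp: first_order_map_def)
    have "re0 (Fz s) = re0 (Fw s) * s"
      using redF[of s] by (simp add: F phi0_def)
    moreover have "Gz (1 / s) = c * Fz s"
      using c(2) by (simp add: F G)
    ultimately have "re0 (Gz (1 / s)) = re0 c * re0 (Fw s) * s" by simp
    then show ?thesis
      using c redF[of s] by (simp add: N_def M_def normal_part_scale del: normal_part.simps)
  qed
  ultimately have N: "N (- b / a) = N 0 + M 0 * (- b / a)"
    by (rule linear_if_simple_pole_at_infinity)
  have disp: "normal_part a b q = node_weight a P * c * b1 f a b P"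
    if "c \<noteq> 0 \<and> reduce_quad q = scale_quad c (node_quad a b P)"
      "fun_X f a b P q = 0" "fun_Z f a b P q = 0" for P q c
  proof -
    note q = coords_at_node[OF a conjunct1[OF that(1)] conjunct2[OF that(1)]]
    have "re1 (coord_v P q) - kappa a b P * re1 (coord_u P q) = b1 f a b P"
      using fun_X_Z_zero_iff[OF q(1-3) f1] that(2,3) by blast
    then show ?thesis by (simp only: q(4))
  qed
  have N1: "N (- b / a) = a * b1 f a b Px"
    using disp[of "re0 (Fw (- b / a))" "quad_at F (- b / a)" Px] redF[of "- b / a"]
      log_lift_at_zero[OF logF(1)] by (simp add: N_def)
  have N0: "N 0 = b1 f a b Pz"
    using disp[of "re0 (Fw 0)" "quad_at F 0" Pz] redF[of 0]
      log_lift_at_zero[OF logF(2)] by (simp add: N_def)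
  have M0: "M 0 = - a\<^sup>2 * b1 f a b Pw"
    using disp[of "re0 (Gz 0)" "quad_at G 0" Pw] redG[of 0]
      log_lift_at_zero[OF logG] by (simp add: M_def)
  have "- a\<^sup>2 * b1 f a b Pw * (- b / a) = a * b * b1 f a b Pw"
    using a by (simp add: power2_eq_square)
  with N have "a * b1 f a b Px = b1 f a b Pz + a * b * b1 f a b Pw"
    unfolding N1 N0 M0 by (rule trans[OF _ arg_cong])
  then show ?thesis by simp
qed

section \<open>Binary forms\<close>

text \<open>The quartic restricted to the line is a binary form of degree 4. Coefficients are needed so that
  the factors for the zeros at \<open>[0 : 1]\<close> and \<open>[1 : 0]\<close> can be split off symmetrically.\<close>

definition binary_form :: "nat \<Rightarrow> (complex \<Rightarrow> complex \<Rightarrow> complex) \<Rightarrow> bool" where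
  "binary_form d g \<longleftrightarrow> (\<exists>c. \<forall>s r. g s r = (\<Sum>m\<le>d. c m * s ^ m * r ^ (d - m)))"

lemma binary_form_const: "binary_form 0 (\<lambda>s r. c)"
  unfolding binary_form_def by (intro exI[of _ "\<lambda>_. c"]) simp

lemma binary_form_add:
  assumes "binary_form d g" "binary_form d h"
  shows "binary_form d (\<lambda>s r. g s r + h s r)"
proof -
  obtain c e where "\<forall>s r. g s r = (\<Sum>m\<le>d. c m * s ^ m * r ^ (d - m))"
    "\<forall>s r. h s r = (\<Sum>m\<le>d. e m * s ^ m * r ^ (d - m))"
    using assms unfolding binary_form_def by blast
  then show ?thesis
    unfolding binary_form_def
    by (intro exI[of _ "\<lambda>m. c m + e m"]) (simp add: sum.distrib algebra_simps)
qed

lemma binary_form_mult_linear: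
  assumes "binary_form d g"
  shows "binary_form (Suc d) (\<lambda>s r. (\<beta> * s + \<gamma> * r) * g s r)"
proof -
  obtain c where c: "\<And>s r. g s r = (\<Sum>m\<le>d. c m * s ^ m * r ^ (d - m))"
    using assms unfolding binary_form_def by blast
  have "binary_form (Suc d) (\<lambda>s r. \<beta> * s * g s r)"
    unfolding binary_form_def
  proof (intro exI[of _ "\<lambda>m. case m of 0 \<Rightarrow> 0 | Suc k \<Rightarrow> \<beta> * c k"] allI)
    fix s r
    show "\<beta> * s * g s r =
      (\<Sum>m\<le>Suc d. (case m of 0 \<Rightarrow> 0 | Suc k \<Rightarrow> \<beta> * c k) * s ^ m * r ^ (Suc d - m))"
      unfolding c by (simp add: sum.atMost_Suc_shift sum_distrib_left mult_ac del: sum.atMost_Suc)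
  qed
  moreover have "binary_form (Suc d) (\<lambda>s r. \<gamma> * r * g s r)"
    unfolding binary_form_def
  proof (intro exI[of _ "\<lambda>m. if m \<le> d then \<gamma> * c m else 0"] allI)
    fix s r
    have "\<gamma> * r * g s r = (\<Sum>m\<le>d. \<gamma> * c m * s ^ m * r ^ (Suc d - m))"
      unfolding c sum_distrib_left by (intro sum.cong) (simp_all add: Suc_diff_le mult_ac)
    then show "\<gamma> * r * g s r =
      (\<Sum>m\<le>Suc d. (if m \<le> d then \<gamma> * c m else 0) * s ^ m * r ^ (Suc d - m))"
      by simp
  qed
  ultimately show ?thesis
    using binary_form_add by (fastforce simp: distrib_right)
qed

lemma binary_form_mult_linear_power:
  "binary_form d g \<Longrightarrow> binary_form (n + d) (\<lambda>s r. (\<beta> * s + \<gamma> * r) ^ n * g s r)"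
proof (induction n)
  case (Suc n)
  then show ?case
    using binary_form_mult_linear[of "n + d" "\<lambda>s r. (\<beta> * s + \<gamma> * r) ^ n * g s r" \<beta> \<gamma>]
    by (simp add: mult.assoc)
qed simp

lemma binary_form_sum:
  assumes "finite A" "\<And>i. i \<in> A \<Longrightarrow> binary_form d (g i)"
  shows "binary_form d (\<lambda>s r. \<Sum>i\<in>A. g i s r)"
  using assms
proof (induction A rule: finite_induct)
  case empty
  show ?case unfolding binary_form_def by (intro exI[of _ "\<lambda>_. 0"]) simp
next
  case (insert i A)
  then show ?case using binary_form_add[of d "g i" "\<lambda>s r. \<Sum>i\<in>A. g i s r"] by simp
qed

lemma binary_form_quartic_on_line:
  "binary_form 4 (\<lambda>s r. quartic_eval id f (phi0 a b s r))"
  unfolding phi0_def quartic_eval.simps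
proof (intro binary_form_sum finite_quartic_exponents)
  fix e assume e: "e \<in> quartic_exponents"
  obtain i j k l where ijkl: "e = (i, j, k, l)" by (cases e)
  \<comment> \<open>Every factor is written as a power of a linear form; for \<open>j > 0\<close> the monomial vanishes
      since \<open>y = 0\<close> on the line.\<close>
  have "binary_form (i + (k + (l + 0)))
      (\<lambda>s r. (- a * s + (- b) * r) ^ i * ((1 * s + 0 * r) ^ k * ((0 * s + 1 * r) ^ l * (f e * 0 ^ j))))"
    by (intro binary_form_mult_linear_power binary_form_const)
  moreover have "binary_form 4 (\<lambda>s r. 0)"
    unfolding binary_form_def by (intro exI[of _ "\<lambda>_. 0"]) simp
  ultimately show "binary_form 4 (\<lambda>s r. case e of (i, j, k, l) \<Rightarrow>
      id (f (i, j, k, l)) * (- a * s - b * r) ^ i * 0 ^ j * s ^ k * r ^ l)"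
    using e by (cases "j = 0") (simp_all add: ijkl quartic_exponents_def mult_ac add.assoc power_0_left)
qed

text \<open>The zeros at \<open>Pz\<close> and \<open>Pw\<close> remove the extreme coefficients \<open>c\<^sub>0\<close>, \<open>c\<^sub>4\<close>, and the zero at \<open>Px\<close>
  determines \<open>c\<^sub>2\<close>. The cofactor is then read off from \<open>c\<^sub>3 = a h\<^sub>1\<close> and \<open>c\<^sub>1 = b h\<^sub>0\<close>.\<close>

lemma quartic_on_line_factorization:
  assumes ab: "a \<noteq> 0" "b \<noteq> 0"
    and zero: "\<And>P. quartic_eval id f (node_quad a b P) = 0"
  obtains h where "\<And>s r. quartic_eval id f (phi0 a b s r) =
    s * r * (a * s + b * r) * (fst h * s + snd h * r)"
proof -
  let ?g = "\<lambda>s r. quartic_eval id f (phi0 a b s r)"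
  obtain c where "\<And>s r. ?g s r = (\<Sum>m\<le>4. c m * s ^ m * r ^ (4 - m))"
    using binary_form_quartic_on_line[of f a b] unfolding binary_form_def by blast
  then have g: "?g s r = c 0 * r ^ 4 + c 1 * s * r ^ 3 + c 2 * s ^ 2 * r ^ 2 + c 3 * s ^ 3 * r + c 4 * s ^ 4"
    for s r by (simp add: numeral_eq_Suc)
  have c0: "c 0 = 0" using zero[of Pz] g[of 0 1] by simp
  have c4: "c 4 = 0" using zero[of Pw] g[of 1 0] by simp
  have "c 1 * (- b / a) + c 2 * (- b / a) ^ 2 + c 3 * (- b / a) ^ 3 = 0"
    using zero[of Px] g[of "- b / a" 1] c0 c4 by simp
  moreover have "c 1 * (- b / a) + c 2 * (- b / a) ^ 2 + c 3 * (- b / a) ^ 3 =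
      (b / a)\<^sup>2 * (c 2 - (a * (c 1 / b) + b * (c 3 / a)))"
    using ab by (simp add: field_simps power2_eq_square power3_eq_cube)
  ultimately have c2: "c 2 = a * (c 1 / b) + b * (c 3 / a)"
    using ab by simp
  define h where "h = (c 3 / a, c 1 / b)"
  have c1: "c 1 = b * snd h" and c3: "c 3 = a * fst h"
    using ab by (simp_all add: h_def)
  have "?g s r = s * r * (a * s + b * r) * (fst h * s + snd h * r)" for s r
    unfolding g c0 c4 c2 c1 c3 using ab
    by (simp add: algebra_simps power2_eq_square power3_eq_cube)
  then show ?thesis by (rule that)
qed

section \<open>Construction of a linear lift\<close>

definition linear_form :: "complex \<times> complex \<Rightarrow> complex \<Rightarrow> complex \<Rightarrow> complex" where
  "linear_form m s r = fst m * s + snd m * r"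

text \<open>The \<open>t\<close>-coefficients of the four coordinates are given by the linear forms in \<open>m\<close>. Homogeneity
  makes the values on the two charts agree on the overlap up to the unit \<open>1 / s\<close>.\<close>

definition linear_lift ::
  "complex \<Rightarrow> complex \<Rightarrow> (complex \<times> complex) quad \<Rightarrow> complex \<Rightarrow> complex \<Rightarrow> dual quad" where
  "linear_lift a b m s r = (case m of (X, H, Z, W) \<Rightarrow>
     (Dual (- a * s - b * r) (linear_form X s r), Dual 0 (linear_form H s r),
      Dual s (linear_form Z s r), Dual r (linear_form W s r)))"

fun node_param :: "complex \<Rightarrow> complex \<Rightarrow> node \<Rightarrow> complex" where
  "node_param a b Px = - b / a" | "node_param a b Pz = 0" | "node_param a b Pw = 0"

fun node_chart :: "node \<Rightarrow> (complex \<Rightarrow> complex \<Rightarrow> 'a) \<Rightarrow> complex \<Rightarrow> 'a" where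
  "node_chart Px L s = L s 1" | "node_chart Pz L s = L s 1" | "node_chart Pw L r = L 1 r"

text \<open>The function \<open>u / (s - p)\<close> modulo \<open>t\<close>.\<close>

fun node_slope :: "complex \<Rightarrow> complex \<Rightarrow> node \<Rightarrow> complex \<Rightarrow> complex" where
  "node_slope a b Px s = - a" | "node_slope a b Pz s = 1" | "node_slope a b Pw r = 1 / (- a - b * r)"

lemma dual_analytic_at_divide:
  assumes "dual_analytic_at g p" "dual_analytic_at h p" "re0 (h p) \<noteq> 0"
  shows "dual_analytic_at (\<lambda>s. g s / h s) p"
  using assms unfolding dual_analytic_at_def dual_parts by (auto intro!: analytic_intros)

lemma dual_analytic_at_Dual:
  assumes "g analytic_on {p}" "h analytic_on {p}"
  shows "dual_analytic_at (\<lambda>s. Dual (g s) (h s)) p"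
  using assms by (simp add: dual_analytic_at_def)

lemma dual_analytic_at_linear:
  "dual_analytic_at (\<lambda>s. Dual (c + d * s) (linear_form m s e)) p"
  "dual_analytic_at (\<lambda>s. Dual (c + d * s) (linear_form m e s)) p"
  unfolding dual_analytic_at_def linear_form_def by (auto intro!: analytic_intros)

lemma reduce_linear_lift:
  "reduce_quad (linear_lift a b m s r) = scale_quad 1 (phi0 a b s r)"
  by (simp add: linear_lift_def phi0_def split: prod.split)

text \<open>Modulo \<open>t\<close> the product \<open>x z w\<close> is \<open>- s r (a s + b r)\<close>, so that the choice \<open>y = t h\<close> with \<open>h\<close> the
  cofactor of the quartic satisfies the equation of the total space.\<close>

lemma first_order_map_linear_lift:
  fixes X H Z W :: "complex \<times> complex"
  assumes factor: "\<And>s r. quartic_eval id f (phi0 a b s r) =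
      s * r * (a * s + b * r) * linear_form H s r"
  defines "L \<equiv> linear_lift a b (X, H, Z, W)"
  shows "\<exists>F G. first_order_map f a b F G \<and> quad_at F = (\<lambda>s. L s 1) \<and> quad_at G = L 1"
proof -
  define F where "F = (\<lambda>s. Dual (- a * s - b) (linear_form X s 1), \<lambda>s. Dual 0 (linear_form H s 1),
      \<lambda>s. Dual s (linear_form Z s 1), \<lambda>s. Dual 1 (linear_form W s 1))"
  define G where "G = (\<lambda>r. Dual (- a - b * r) (linear_form X 1 r), \<lambda>r. Dual 0 (linear_form H 1 r),
      \<lambda>r. Dual 1 (linear_form Z 1 r), \<lambda>r. Dual r (linear_form W 1 r))"
  have F: "quad_at F = (\<lambda>s. L s 1)" and G: "quad_at G = L 1"
    by (auto simp: F_def G_def L_def linear_lift_def)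
  have total: "on_total_space f (L s r)" for s r
  proof -
    have "reduce_quad (L s r) = phi0 a b s r"
      unfolding L_def reduce_linear_lift by (simp add: phi0_def)
    then have "re0 (quartic_eval cst f (L s r)) = s * r * (a * s + b * r) * linear_form H s r"
      by (simp only: re0_quartic_eval factor)
    then show ?thesis
      by (simp add: L_def linear_lift_def dual_eq_iff algebra_simps del: quartic_eval.simps)
  qed
  have "L 1 (1 / s) = scale_quad (cst (1 / s)) (L s 1)" if "s \<noteq> 0" for s
    using that by (simp add: L_def linear_lift_def linear_form_def dual_eq_iff field_simps)
  then have "\<exists>c. re0 c \<noteq> 0 \<and> L 1 (1 / s) = scale_quad c (L s 1)" if "s \<noteq> 0" for s
    using that by (intro exI[of _ "cst (1 / s)"]) simp
  moreover have "quad_holomorphic F" "quad_holomorphic G"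
    by (auto simp: F_def G_def dual_holomorphic_on_def linear_form_def intro!: holomorphic_intros)
  moreover have "\<exists>c. c \<noteq> 0 \<and> reduce_quad (L s r) = scale_quad c (phi0 a b s r)" for s r
    unfolding L_def reduce_linear_lift by (intro exI[of _ 1]) simp
  ultimately have "first_order_map f a b F G"
    unfolding first_order_map_def F G using total by blast
  with F G show ?thesis by blast
qed

lemma log_lift_at_linear_lift:
  fixes X H Z W :: "complex \<times> complex"
  assumes ab: "a \<noteq> 0" "b \<noteq> 0"
    and f1: "poly (loc_f1 f a b P) 0 \<noteq> 0"
    and zero: "quartic_eval id f (hom_coords P 0 (alpha a b P) 0) = 0"
    and factor: "\<And>s r. quartic_eval id f (phi0 a b s r) =
      s * r * (a * s + b * r) * linear_form H s r"
  defines "L \<equiv> node_chart P (linear_lift a b (X, H, Z, W))"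
  assumes u1: "re1 (coord_u P (L (node_param a b P))) = - val_f4 id f a b P 0 0 0"
    and n1: "normal_part a b (L (node_param a b P)) = node_weight a P * b1 f a b P"
  shows "log_lift_at f a b P (node_param a b P) L"
proof -
  let ?p = "node_param a b P"
  have "reduce_quad (L ?p) = scale_quad 1 (node_quad a b P)"
    by (cases P) (simp_all only: L_def node_chart.simps node_param.simps node_quad.simps
        reduce_linear_lift)
  note center = coords_at_node[OF ab(1) one_neq_zero this]
  have "node_weight a P \<noteq> 0" using ab by (cases P) simp_all
  then have "re1 (coord_v P (L ?p)) - kappa a b P * re1 (coord_u P (L ?p)) = b1 f a b P"
    using n1 center(4) by simp
  then have XZ: "fun_X f a b P (L ?p) = 0" "fun_Z f a b P (L ?p) = 0"
    using fun_X_Z_zero_iff[OF center(1-3) f1] u1 by blast+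
  have an: "dual_analytic_at (\<lambda>s. coord_u P (L s)) ?p" "dual_analytic_at (\<lambda>s. coord_v P (L s)) ?p"
      "dual_analytic_at (\<lambda>s. coord_y P (L s)) ?p"
  proof -
    have chart: "L s = (Dual (- b + (- a) * s) (linear_form X s 1), Dual (0 + 0 * s) (linear_form H s 1),
        Dual (0 + 1 * s) (linear_form Z s 1), Dual (1 + 0 * s) (linear_form W s 1))"
      if "P \<noteq> Pw" for s
      using that by (cases P) (simp_all add: L_def linear_lift_def)
    have chart': "L r = (Dual (- a + (- b) * r) (linear_form X 1 r), Dual (0 + 0 * r) (linear_form H 1 r),
        Dual (1 + 0 * r) (linear_form Z 1 r), Dual (0 + 1 * r) (linear_form W 1 r))"
      if "P = Pw" for r
      using that by (simp add: L_def linear_lift_def)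
    have "dual_analytic_at (\<lambda>s. coord_u P (L s)) ?p \<and> dual_analytic_at (\<lambda>s. coord_v P (L s)) ?p \<and>
      dual_analytic_at (\<lambda>s. coord_y P (L s)) ?p"
    proof (cases "P = Pw")
      case True
      show ?thesis
        unfolding chart'[OF True] unfolding True coord_u.simps coord_v.simps coord_y.simps
        using ab(1) by (intro conjI dual_analytic_at_divide dual_analytic_at_linear) simp_all
    next
      case False
      then show ?thesis
        unfolding chart[OF False]
        by (cases P; simp only: coord_u.simps coord_v.simps coord_y.simps;
          intro conjI dual_analytic_at_divide dual_analytic_at_linear; simp)
    qed
    then show "dual_analytic_at (\<lambda>s. coord_u P (L s)) ?p" "dual_analytic_at (\<lambda>s. coord_v P (L s)) ?p"
      "dual_analytic_at (\<lambda>s. coord_y P (L s)) ?p" by blast+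
  qed
  have slope: "node_slope a b P analytic_on {?p}" "node_slope a b P ?p \<noteq> 0"
  proof -
    have "(\<lambda>s. 1 / (- a - b * s)) analytic_on {0}"
      using ab(1) by (intro analytic_intros) auto
    moreover have "node_slope a b Px = (\<lambda>_. - a)" "node_slope a b Pz = (\<lambda>_. 1)"
        "node_slope a b Pw = (\<lambda>s. 1 / (- a - b * s))"
      by (auto simp: fun_eq_iff)
    ultimately show "node_slope a b P analytic_on {?p}"
      by (cases P) (simp_all add: analytic_on_const)
    show "node_slope a b P ?p \<noteq> 0"
      using ab(1) by (cases P) simp_all
  qed
  let ?u = "\<lambda>s. re0 (coord_u P (L s))" and ?v = "\<lambda>s. re0 (coord_v P (L s))"
    and ?y = "\<lambda>s. coord_y P (L s)"
  have ev: "\<forall>\<^sub>F s in nhds ?p. ?u s = (s - ?p) * node_slope a b P s \<and>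
      ?v s = kappa a b P * ?u s + alpha a b P \<and> re0 (?y s) = 0 \<and>
      ?u s * ?v s * re1 (?y s) + quartic_eval id f (hom_coords P (?u s) (?v s) 0) = 0"
  proof (cases P)
    case Px
    have "quartic_eval id f (- a * s - b, 0, s, 1) = s * (a * s + b) * linear_form H s 1" for s
      using factor[of s 1] by (simp add: phi0_def del: quartic_eval.simps)
    then show ?thesis
      using ab by (intro always_eventually allI)
        (simp add: Px L_def linear_lift_def algebra_simps diff_divide_distrib add_divide_distrib del: quartic_eval.simps)
  next
    case Pz
    have "quartic_eval id f (- a * s - b, 0, s, 1) = s * (a * s + b) * linear_form H s 1" for s
      using factor[of s 1] by (simp add: phi0_def del: quartic_eval.simps)
    then show ?thesis
      by (intro always_eventually allI)
        (simp add: Pz L_def linear_lift_def algebra_simps del: quartic_eval.simps)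
  next
    case Pw
    have "((\<lambda>r. - a - b * r) \<longlongrightarrow> - a - b * 0) (nhds 0)"
      by (intro tendsto_intros filterlim_ident)
    then have "\<forall>\<^sub>F r in nhds 0. - a - b * r \<noteq> 0"
      by (rule tendsto_imp_eventually_ne) (use ab(1) in simp)
    then have "\<forall>\<^sub>F r in nhds 0. ?u r = (r - 0) * node_slope a b P r \<and>
      ?v r = kappa a b P * ?u r + alpha a b P \<and> re0 (?y r) = 0 \<and>
      ?u r * ?v r * re1 (?y r) + quartic_eval id f (hom_coords P (?u r) (?v r) 0) = 0"
    proof eventually_elim
      case (elim r)
      define d where "d = - a - b * r"
      have d: "d \<noteq> 0" using elim by (simp add: d_def)
      have r: "b * r = - a - d" by (simp add: d_def)
      have uvy: "?u r = r / d" "?v r = 1 / d" "re0 (?y r) = 0" "re1 (?y r) = linear_form H 1 r / d"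
        by (simp_all add: Pw L_def linear_lift_def d_def)
      \<comment> \<open>In the coordinates normalised by \<open>x = 1\<close> the point of the line has parameters
          \<open>s = v\<close>, \<open>r = u\<close>, and the factorisation applies to these.\<close>
      have "- a * (1 / d) - b * (r / d) = 1"
        using d by (simp add: field_simps r)
      then have "quartic_eval id f (1, 0, 1 / d, r / d) =
          1 / d * (r / d) * (a * (1 / d) + b * (r / d)) * linear_form H (1 / d) (r / d)"
        using factor[of "1 / d" "r / d"] by (simp only: phi0_def)
      moreover have "a * (1 / d) + b * (r / d) = - 1"
        using d by (simp add: field_simps r)
      moreover have "linear_form H (1 / d) (r / d) = linear_form H 1 r / d"
        by (simp add: linear_form_def add_divide_distrib)
      ultimately have "?u r * ?v r * re1 (?y r) + quartic_eval id f (hom_coords P (?u r) (?v r) 0) = 0"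
        unfolding uvy by (simp add: Pw del: quartic_eval.simps)
      moreover have "1 / d = - b / a * (r / d) + - 1 / a"
        using d ab(1) by (simp add: field_simps r)
      then have "?v r = kappa a b P * ?u r + alpha a b P"
        unfolding uvy by (simp only: Pw kappa.simps alpha.simps)
      moreover have "?u r = (r - 0) * node_slope a b P r"
        unfolding uvy by (simp add: Pw d_def)
      ultimately show ?case
        using uvy(3) by blast
    qed
    then show ?thesis by (simp add: Pw)
  qed
  show ?thesis
    by (rule log_lift_atI[OF ab f1 zero an slope _ _ XZ])
      (use ev in \<open>auto elim: eventually_mono\<close>)
qed

text \<open>The forms \<open>n\<close>, \<open>Z\<close>, \<open>W\<close> are chosen, and \<open>X = n - a Z - b W\<close>. The form \<open>n\<close> is fixed by its
  values at \<open>Pz\<close> and \<open>Pw\<close>, and the relation gives the value at \<open>Px\<close>. The prescribed \<open>u\<^sub>1\<close> at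
  \<open>Pz\<close> and \<open>Pw\<close> determine the values of \<open>Z\<close> and \<open>W\<close> there, and the one at \<open>Px\<close> is met by the free coefficient
  \<open>z\<^sub>1\<close> of \<open>Z\<close>. The remaining coefficient of \<open>W\<close> is set to \<open>0\<close>: it only reflects the rescaling
  of all coordinates by a unit \<open>1 + c t\<close>.\<close>

lemma relation_imp_lift:
  assumes ab: "a \<noteq> 0" "b \<noteq> 0"
    and f1: "\<And>P. poly (loc_f1 f a b P) 0 \<noteq> 0"
    and zero: "\<And>P. quartic_eval id f (hom_coords P 0 (alpha a b P) 0) = 0"
    and rel: "a * b1 f a b Px - a * b * b1 f a b Pw - b1 f a b Pz = 0"
  shows "has_first_order_lift f a b"
proof -
  have "quartic_eval id f (node_quad a b P) = 0" for P
  proof -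
    have "node_quad a b P = scale_quad (if P = Pw then - a else 1) (hom_coords P 0 (alpha a b P) 0)"
      using ab by (cases P) (simp_all add: phi0_def)
    then show ?thesis by (simp only: quartic_eval_scale zero mult_zero_right)
  qed
  then obtain H where factor: "\<And>s r. quartic_eval id f (phi0 a b s r) =
      s * r * (a * s + b * r) * linear_form H s r"
    using quartic_on_line_factorization[OF ab] unfolding linear_form_def by metis
  define U where "U = (\<lambda>P. - val_f4 id f a b P 0 0 0)"
  define n0 n1 where "n0 = b1 f a b Pz" and "n1 = - a\<^sup>2 * b1 f a b Pw"
  define z0 w1 z1 where "z0 = U Pz" and "w1 = - a * U Pw"
    and "z1 = (U Px - a * b1 f a b Px + a * U Pz + b\<^sup>2 * U Pw) / b"
  define L where "L = linear_lift a b ((n1 - a * z1 - b * w1, n0 - a * z0), H, (z1, z0), (w1, 0))"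
  have normal: "normal_part a b (L s r) = n1 * s + n0 * r" for s r
    by (simp add: L_def linear_lift_def linear_form_def algebra_simps)
  have nPx: "n1 * (- b / a) + n0 = a * b1 f a b Px"
  proof -
    have "n1 * (- b / a) = a * b * b1 f a b Pw"
      using ab by (simp add: n1_def power2_eq_square)
    then show ?thesis using rel by (simp add: n0_def algebra_simps)
  qed
  have n: "normal_part a b (node_chart P L (node_param a b P)) = node_weight a P * b1 f a b P" for P
    using nPx by (cases P) (simp_all add: normal n0_def n1_def)
  have u: "re1 (coord_u P (node_chart P L (node_param a b P))) = U P" for P
  proof (cases P)
    case Px
    have "re1 (coord_u Px (L (- b / a) 1)) =
        (n1 * (- b / a) + n0) + b * z1 - a * z0 - b * w1 * (- b / a)"
      using ab by (simp add: L_def linear_lift_def linear_form_def field_simps)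
    also have "\<dots> = U Px"
      using ab unfolding nPx z1_def z0_def w1_def by (simp add: power2_eq_square)
    finally show ?thesis using Px by simp
  qed (use ab in \<open>simp_all add: L_def linear_lift_def linear_form_def z0_def w1_def\<close>)
  have log: "log_lift_at f a b P (node_param a b P) (node_chart P L)" for P
    using log_lift_at_linear_lift[OF ab f1 zero factor] u n unfolding L_def U_def by blast
  obtain F G where "first_order_map f a b F G" "quad_at F = (\<lambda>s. L s 1)" "quad_at G = L 1"
    using first_order_map_linear_lift[OF factor] unfolding L_def by blast
  moreover have "node_chart Px L = (\<lambda>s. L s 1)" "node_chart Pz L = (\<lambda>s. L s 1)" "node_chart Pw L = L 1"
    by auto
  ultimately show ?thesis
    unfolding has_first_order_lift_def
    using log[of Px] log[of Pz] log[of Pw] by (intro exI[of _ F] exI[of _ G]) simp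
qed

theorem theorem16:
  fixes f :: quartic and a b :: complex
  assumes "a \<noteq> 0" and "b \<noteq> 0"
    and "card (sing_pts f) = 24"
    and "torus_fixed_pts \<inter> sing_pts f = {}"
    and "the_line a b \<inter> coord_lines \<subseteq> sing_pts f"
  shows "has_first_order_lift f a b \<longleftrightarrow> a * b1 f a b Px - a * b * b1 f a b Pw - b1 f a b Pz = 0"
proof -
  have zero: "quartic_eval id f (hom_coords P 0 (alpha a b P) 0) = 0" for P
    using assms(1,5) by (rule quartic_vanishes_at_nodes)
  have f1: "poly (loc_f1 f a b P) 0 \<noteq> 0" for P
    using assms(3,4) zero by (rule loc_f1_nonzero)
  show ?thesis
    using lift_imp_relation[OF assms(1) f1] relation_imp_lift[OF assms(1,2) f1 zero] by blast
qed

end
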